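(* Let $N, n$ be positive integers and let $\mathcal{E}$ be a complex Hilbert space. Let $Z_1,\ldots,Z_n$ be distinct elements of $\mathcal{B}_N(\mathcal{E})$ and let $B_1,\ldots,B_n\in\mathcal{L}(\mathcal{E})$. Then there exists $T\in\mathcal{S}(\mathcal{H},\mathcal{E})$ such that $T(Z_k)=B_k$ for $k=1,\ldots,n$ if and only if the Pick matrix $$P=\left[\,L(Z_j)\,\mathrm{diag}[\,I-B_j^*B_k\,]\,L(Z_k)^*\,\right]_{j,k=1}^n ,$$ viewed as an operator on $\mathcal{E}^{\oplus n}$, is positive (i.e. positive semidefinite).
   Context: $\mathcal{L}(\mathcal{E})$ is the algebra of bounded linear operators on $\mathcal{E}$, and $\mathcal{H}=\mathbb{C}^N$ (it enters only through $N$). For $Z=[Z_1\ \ldots\ Z_N]\in\mathcal{L}(\mathcal{E})^N$ put $(Z|Z)=\sum_{k=1}^N Z_k^*Z_k$, and let $\mathcal{B}_N(\mathcal{E})=\{Z\in\mathcal{L}(\mathcal{E})^N : (Z|Z)<I_{\mathcal{E}}\}$, where $<$ means that $I_{\mathcal E}-(Z|Z)$ is positive and boundedly invertible. (In the claim each $Z_j$ is itself an $N$-tuple.) $\mathbb{F}_N^+$ is the unital free semigroup on generators $1,\ldots,N$; $|\sigma|$ is the length of a word $\sigma$; words are ordered by length and, within a given length, lexicographically. For $\sigma=i_1\cdots i_k$ set $Z^*_\sigma=Z_{i_1}^*\cdots Z_{i_k}^*$, and $Z^*_\emptyset=I_{\mathcal E}$. Define $\mathcal{E}_0=\mathcal{E}$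 and $\mathcal{E}_k=\mathcal{E}_{k-1}^{\oplus N}$ ($N$ summands) for $k\ge 1$. Thus $\mathcal{E}_k=\bigoplus_{|\sigma|=k}\mathcal{E}$, with summands indexed by words of length $k$ in lexicographic order (the outermost summand index being the first letter). For $Z\in\mathcal{B}_N(\mathcal{E})$, $L(Z)=[Z^*_\sigma]_{|\sigma|=0}^{\infty}$ is the row operator $L(Z):\bigoplus_{k=0}^\infty\mathcal{E}_k\to\mathcal{E}$ (bounded) whose entry at the summand indexed by $\sigma$ is $Z^*_\sigma$. $\mathcal{U}_{\mathcal T}(\mathcal{H},\mathcal{E})$ is the set of upper triangular operators $T=[T_{ij}]_{i,j=0}^\infty\in\mathcal{L}(\bigoplus_{k=0}^\infty\mathcal{E}_k)$, $T_{ij}\in\mathcal{L}(\mathcal{E}_j,\mathcal{E}_i)$, $T_{ij}=0$ for $i>j$, such that $T_{ij}=T_{i-1,j-1}^{\oplus N}$ (the direct sum of $N$ copies of $T_{i-1,j-1}$) for all $1\le i\le j$. $\mathcal{S}(\mathcal{H},\mathcal{E})$ is the set of contractions in $\mathcal{U}_{\mathcal T}(\mathcal{H},\mathcal{E})$. For $X\in\mathcal{L}(\mathcal{E})$, $\mathrm{diag}[X]$ is the operator on $\bigoplus_{k=0}^\infty\mathcal{E}_k$ which is the direct sum of copies of $X$, one on each summand $\mathcal{E}$ indexed by $\sigma\in\mathbb{F}_N^+$. For $T\in\mathcal{U}_{\mathcal T}(\mathcal{H},\mathcal{E})$ and $Z\in\mathcal{B}_N(\mathcal{E})$, the point evaluation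 is $T(Z)=P_{\mathcal{E}}\,T\,L(Z)^*\in\mathcal{L}(\mathcal{E})$, where $P_{\mathcal E}$ is the orthogonal projection of $\bigoplus_{k=0}^\infty\mathcal{E}_k$ onto $\mathcal{E}=\mathcal{E}_0$. *)

theory Defs
  imports "HOL-Analysis.Analysis"
begin

section \<open>Complex Hilbert spaces\<close>

text \<open>The inner product is linear in its first argument and conjugate-linear in the second.
  Norm, real scalar multiplication and topology are those of \<^class>\<open>real_normed_vector\<close>, so that
  the library's type of bounded operators is available; complex linearity is imposed separately.\<close>

class complex_inner = real_normed_vector +
  fixes scaleC :: "complex \<Rightarrow> 'a \<Rightarrow> 'a" (infixr \<open>*\<^sub>C\<close> 75)
    and cinner :: "'a \<Rightarrow> 'a \<Rightarrow> complex"
  assumes scaleC_add_right: "c *\<^sub>C (x + y) = c *\<^sub>C x + c *\<^sub>C y"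
    and scaleC_add_left: "(c + d) *\<^sub>C x = c *\<^sub>C x + d *\<^sub>C x"
    and scaleC_scaleC: "c *\<^sub>C d *\<^sub>C x = (c * d) *\<^sub>C x"
    and scaleC_of_real: "complex_of_real r *\<^sub>C x = r *\<^sub>R x"
    and cinner_commute: "cinner x y = cnj (cinner y x)"
    and cinner_add_left: "cinner (x + y) z = cinner x z + cinner y z"
    and cinner_scaleC_left: "cinner (c *\<^sub>C x) y = c * cinner x y"
    and cinner_self: "cinner x x = complex_of_real ((norm x)\<^sup>2)"

class chilbert_space = complex_inner + complete_space

subclass (in chilbert_space) banach ..

instantiation complex :: chilbert_space
begin

definition scaleC_complex :: "complex \<Rightarrow> complex \<Rightarrow> complex" where
  "scaleC_complex c x = c * x"

definition cinner_complex :: "complex \<Rightarrow> complex \<Rightarrow> complex" where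
  "cinner_complex x y = x * cnj y"

instance
  by standard
    (simp_all add: scaleC_complex_def cinner_complex_def algebra_simps scaleR_conv_of_real
      complex_norm_square[symmetric])

end

lemma cinner_add_right: "cinner x (y + z) = cinner x y + cinner x (z::'a::complex_inner)"
  by (metis cinner_add_left cinner_commute complex_cnj_add)

lemma cinner_scaleC_right: "cinner x (c *\<^sub>C y) = cnj c * cinner x (y::'a::complex_inner)"
  by (metis cinner_scaleC_left cinner_commute complex_cnj_mult)

lemma norm_scaleC: "norm (c *\<^sub>C x) = cmod c * norm (x::'a::complex_inner)"
proof -
  have "cinner (c *\<^sub>C x) (c *\<^sub>C x) = c * cnj c * cinner x x"
    by (simp add: cinner_scaleC_left cinner_scaleC_right)
  also have "\<dots> = complex_of_real ((cmod c * norm x)\<^sup>2)"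
    by (simp only: cinner_self power_mult_distrib of_real_mult complex_norm_square[of c])
  finally have "cinner (c *\<^sub>C x) (c *\<^sub>C x) = complex_of_real ((cmod c * norm x)\<^sup>2)" .
  then have "(norm (c *\<^sub>C x))\<^sup>2 = (cmod c * norm x)\<^sup>2"
    by (metis cinner_self of_real_eq_iff)
  then show ?thesis
    by (simp add: power2_eq_iff_nonneg)
qed

lemma cmod_cinner_le: "cmod (cinner x y) \<le> norm x * norm (y::'a::complex_inner)"
proof -
  have Re_le: "Re (cinner u v) \<le> norm u * norm v" for u v :: 'a
  proof -
    have "cinner (u + v) (u + v) = cinner u u + cinner v v + (cinner u v + cnj (cinner u v))"
      by (simp add: cinner_add_left cinner_add_right cinner_commute[of v u])
    then have "Re (cinner (u + v) (u + v)) = Re (cinner u u) + Re (cinner v v) + 2 * Re (cinner u v)"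
      by simp
    then have "(norm (u + v))\<^sup>2 = (norm u)\<^sup>2 + (norm v)\<^sup>2 + 2 * Re (cinner u v)"
      by (simp only: cinner_self Re_complex_of_real)
    moreover have "(norm (u + v))\<^sup>2 \<le> (norm u + norm v)\<^sup>2"
      by (simp add: norm_triangle_ineq power_mono)
    ultimately show ?thesis
      by (simp add: power2_sum)
  qed
  show ?thesis
  proof (cases "cinner x y = 0")
    case False
    define c where "c = cnj (cinner x y) / cmod (cinner x y)"
    have "cmod c = 1"
      using False by (simp add: c_def norm_divide)
    moreover have "cinner (c *\<^sub>C x) y = cmod (cinner x y)"
      using False complex_norm_square[of "cinner x y"]
      by (simp add: cinner_scaleC_left c_def power2_eq_square field_simps)
    ultimately show ?thesis
      using Re_le[of "c *\<^sub>C x" y] by (simp add: norm_scaleC)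
  qed simp
qed


section \<open>Hilbert direct sums of copies of a space\<close>

text \<open>\<open>('i, 'a) ell2\<close> is the Hilbert direct sum of copies of \<open>'a\<close> indexed by \<open>'i\<close>.\<close>

typedef (overloaded) ('i, 'a::complex_inner) ell2 =
  "{f :: 'i \<Rightarrow> 'a. (\<lambda>i. (norm (f i))\<^sup>2) summable_on UNIV}"
  morphisms ell2_nth Abs_ell2
  by (rule exI[of _ "\<lambda>_. 0"]) simp

setup_lifting type_definition_ell2

lemma ell2_eqI: "(\<And>i. ell2_nth f i = ell2_nth g i) \<Longrightarrow> f = g"
  by transfer auto

lemma L2_bounded_imp_ell2:
  fixes f :: "'i \<Rightarrow> 'a::real_normed_vector"
  assumes "\<And>F. finite F \<Longrightarrow> L2_set (\<lambda>i. norm (f i)) F \<le> C"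
  shows "(\<lambda>i. (norm (f i))\<^sup>2) summable_on UNIV" "sqrt (\<Sum>\<^sub>\<infinity>i. (norm (f i))\<^sup>2) \<le> C"
proof -
  have C: "0 \<le> C"
    using assms[of "{}"] by simp
  have le: "(\<Sum>i\<in>F. (norm (f i))\<^sup>2) \<le> C\<^sup>2" if "finite F" for F
    using assms[OF that] C by (simp add: L2_set_def sqrt_le_D)
  show s: "(\<lambda>i. (norm (f i))\<^sup>2) summable_on UNIV"
    by (rule nonneg_bounded_partial_sums_imp_summable_on[where C="C\<^sup>2"])
      (auto intro!: le)
  have "(\<Sum>\<^sub>\<infinity>i. (norm (f i))\<^sup>2) \<le> C\<^sup>2"
    by (rule infsum_le_finite_sums[OF s]) (auto intro: le)
  then show "sqrt (\<Sum>\<^sub>\<infinity>i. (norm (f i))\<^sup>2) \<le> C"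
    using C by (simp add: real_le_lsqrt)
qed

lemma ell2_L2_le:
  fixes f :: "'i \<Rightarrow> 'a::real_normed_vector"
  assumes "(\<lambda>i. (norm (f i))\<^sup>2) summable_on UNIV" "finite F"
  shows "L2_set (\<lambda>i. norm (f i)) F \<le> sqrt (\<Sum>\<^sub>\<infinity>i. (norm (f i))\<^sup>2)"
  unfolding L2_set_def real_sqrt_le_iff
  by (rule finite_sum_le_infsum) (use assms in auto)

lemma ell2_add:
  fixes f g :: "'i \<Rightarrow> 'a::real_normed_vector"
  assumes f: "(\<lambda>i. (norm (f i))\<^sup>2) summable_on UNIV"
    and g: "(\<lambda>i. (norm (g i))\<^sup>2) summable_on UNIV"
  shows "(\<lambda>i. (norm (f i + g i))\<^sup>2) summable_on UNIV"
    "sqrt (\<Sum>\<^sub>\<infinity>i. (norm (f i + g i))\<^sup>2)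
      \<le> sqrt (\<Sum>\<^sub>\<infinity>i. (norm (f i))\<^sup>2) + sqrt (\<Sum>\<^sub>\<infinity>i. (norm (g i))\<^sup>2)"
proof -
  have "L2_set (\<lambda>i. norm (f i + g i)) F
      \<le> sqrt (\<Sum>\<^sub>\<infinity>i. (norm (f i))\<^sup>2) + sqrt (\<Sum>\<^sub>\<infinity>i. (norm (g i))\<^sup>2)" if "finite F" for F
  proof -
    have "L2_set (\<lambda>i. norm (f i + g i)) F \<le> L2_set (\<lambda>i. norm (f i) + norm (g i)) F"
      by (rule L2_set_mono) (auto intro: norm_triangle_ineq)
    also have "\<dots> \<le> L2_set (\<lambda>i. norm (f i)) F + L2_set (\<lambda>i. norm (g i)) F"
      by (rule L2_set_triangle_ineq)
    also have "\<dots> \<le> sqrt (\<Sum>\<^sub>\<infinity>i. (norm (f i))\<^sup>2) + sqrt (\<Sum>\<^sub>\<infinity>i. (norm (g i))\<^sup>2)"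
      by (intro add_mono ell2_L2_le f g that)
    finally show ?thesis .
  qed
  from L2_bounded_imp_ell2[OF this]
  show "(\<lambda>i. (norm (f i + g i))\<^sup>2) summable_on UNIV"
    "sqrt (\<Sum>\<^sub>\<infinity>i. (norm (f i + g i))\<^sup>2)
      \<le> sqrt (\<Sum>\<^sub>\<infinity>i. (norm (f i))\<^sup>2) + sqrt (\<Sum>\<^sub>\<infinity>i. (norm (g i))\<^sup>2)"
    by auto
qed

lemma ell2_cinner_summable:
  fixes f g :: "'i \<Rightarrow> 'a::complex_inner"
  assumes f: "(\<lambda>i. (norm (f i))\<^sup>2) summable_on UNIV"
    and g: "(\<lambda>i. (norm (g i))\<^sup>2) summable_on UNIV"
  shows "(\<lambda>i. cinner (f i) (g i)) summable_on UNIV"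
proof (rule abs_summable_summable, rule summable_on_comparison_test)
  show "(\<lambda>i. (norm (f i))\<^sup>2 + (norm (g i))\<^sup>2) summable_on UNIV"
    by (intro summable_on_add f g)
  fix i
  have "cmod (cinner (f i) (g i)) \<le> norm (f i) * norm (g i)"
    by (rule cmod_cinner_le)
  also have "\<dots> \<le> (norm (f i))\<^sup>2 + (norm (g i))\<^sup>2"
    using sum_squares_bound[of "norm (f i)" "norm (g i)"]
      mult_nonneg_nonneg[OF norm_ge_zero[of "f i"] norm_ge_zero[of "g i"]] by linarith
  finally show "norm (cinner (f i) (g i)) \<le> (norm (f i))\<^sup>2 + (norm (g i))\<^sup>2" .
qed simp

instantiation ell2 :: (type, complex_inner) real_vector
begin

lift_definition zero_ell2 :: "('a, 'b) ell2" is "\<lambda>_. 0"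
  by simp

lift_definition plus_ell2 :: "('a, 'b) ell2 \<Rightarrow> ('a, 'b) ell2 \<Rightarrow> ('a, 'b) ell2"
  is "\<lambda>f g i. f i + g i"
  by (rule ell2_add)

lift_definition uminus_ell2 :: "('a, 'b) ell2 \<Rightarrow> ('a, 'b) ell2" is "\<lambda>f i. - f i"
  by simp

lift_definition minus_ell2 :: "('a, 'b) ell2 \<Rightarrow> ('a, 'b) ell2 \<Rightarrow> ('a, 'b) ell2"
  is "\<lambda>f g i. f i - g i"
  subgoal for f g using ell2_add(1)[of f "\<lambda>i. - g i"] by simp
  done

lift_definition scaleR_ell2 :: "real \<Rightarrow> ('a, 'b) ell2 \<Rightarrow> ('a, 'b) ell2" is "\<lambda>r f i. r *\<^sub>R f i"
  by (simp add: power_mult_distrib summable_on_cmult_right)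

instance
  by standard (transfer, simp add: algebra_simps)+

end

instantiation ell2 :: (type, complex_inner) complex_inner
begin

lift_definition scaleC_ell2 :: "complex \<Rightarrow> ('a, 'b) ell2 \<Rightarrow> ('a, 'b) ell2" is "\<lambda>c f i. c *\<^sub>C f i"
  by (simp add: norm_scaleC power_mult_distrib summable_on_cmult_right)

lift_definition norm_ell2 :: "('a, 'b) ell2 \<Rightarrow> real" is "\<lambda>f. sqrt (\<Sum>\<^sub>\<infinity>i. (norm (f i))\<^sup>2)" .

lift_definition cinner_ell2 :: "('a, 'b) ell2 \<Rightarrow> ('a, 'b) ell2 \<Rightarrow> complex"
  is "\<lambda>f g. \<Sum>\<^sub>\<infinity>i. cinner (f i) (g i)" .

definition sgn_ell2 :: "('a, 'b) ell2 \<Rightarrow> ('a, 'b) ell2" where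
  "sgn_ell2 f = f /\<^sub>R norm f"

definition dist_ell2 :: "('a, 'b) ell2 \<Rightarrow> ('a, 'b) ell2 \<Rightarrow> real" where
  "dist_ell2 f g = norm (f - g)"

definition uniformity_ell2 :: "(('a, 'b) ell2 \<times> ('a, 'b) ell2) filter" where
  "uniformity_ell2 = (INF e\<in>{0<..}. principal {(f, g). dist f g < e})"

definition open_ell2 :: "('a, 'b) ell2 set \<Rightarrow> bool" where
  "open_ell2 U \<longleftrightarrow> (\<forall>f\<in>U. \<forall>\<^sub>F (f', g) in uniformity. f' = f \<longrightarrow> g \<in> U)"

instance
proof
  fix f g h :: "('a, 'b) ell2" and r :: real and c d :: complex
  show "dist f g = norm (f - g)"
    by (rule dist_ell2_def)
  show "sgn f = f /\<^sub>R norm f"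
    by (rule sgn_ell2_def)
  show "uniformity = (INF e\<in>{0<..}. principal {(f::('a, 'b) ell2, g). dist f g < e})"
    by (rule uniformity_ell2_def)
  show "open U \<longleftrightarrow> (\<forall>f\<in>U. \<forall>\<^sub>F (f', g) in uniformity. f' = f \<longrightarrow> g \<in> U)"
    for U :: "('a, 'b) ell2 set"
    by (rule open_ell2_def)
  show "norm f = 0 \<longleftrightarrow> f = 0"
  proof transfer
    fix f :: "'a \<Rightarrow> 'b"
    assume f: "(\<lambda>i. (norm (f i))\<^sup>2) summable_on UNIV"
    have "f i = 0" if "sqrt (\<Sum>\<^sub>\<infinity>i. (norm (f i))\<^sup>2) = 0" for i
      using ell2_L2_le[OF f, of "{i}"] that by simp
    then show "(sqrt (\<Sum>\<^sub>\<infinity>i. (norm (f i))\<^sup>2) = 0) = (f = (\<lambda>_. 0))"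
      by auto
  qed
  show "norm (f + g) \<le> norm f + norm g"
    by transfer (rule ell2_add)
  show "norm (r *\<^sub>R f) = \<bar>r\<bar> * norm f"
    by transfer (simp add: power_mult_distrib infsum_cmult_right' real_sqrt_mult)
  show "c *\<^sub>C (f + g) = c *\<^sub>C f + c *\<^sub>C g"
    by transfer (simp add: scaleC_add_right)
  show "(c + d) *\<^sub>C f = c *\<^sub>C f + d *\<^sub>C f"
    by transfer (simp add: scaleC_add_left)
  show "c *\<^sub>C d *\<^sub>C f = (c * d) *\<^sub>C f"
    by transfer (simp add: scaleC_scaleC)
  show "complex_of_real r *\<^sub>C f = r *\<^sub>R f"
    by transfer (simp add: scaleC_of_real)
  show "cinner f g = cnj (cinner g f)"
    by transfer (simp only: infsum_cnj[symmetric] cinner_commute[symmetric])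
  show "cinner (f + g) h = cinner f h + cinner g h"
    by transfer (simp add: cinner_add_left infsum_add ell2_cinner_summable)
  show "cinner (c *\<^sub>C f) g = c * cinner f g"
    by transfer (simp add: cinner_scaleC_left infsum_cmult_right')
  show "cinner f f = complex_of_real ((norm f)\<^sup>2)"
  proof transfer
    fix f :: "'a \<Rightarrow> 'b"
    assume f: "(\<lambda>i. (norm (f i))\<^sup>2) summable_on UNIV"
    have "((\<lambda>i. complex_of_real ((norm (f i))\<^sup>2)) has_sum
        complex_of_real (\<Sum>\<^sub>\<infinity>i. (norm (f i))\<^sup>2)) UNIV"
      using f by (simp only: has_sum_of_real_iff has_sum_infsum)
    then show "(\<Sum>\<^sub>\<infinity>i. cinner (f i) (f i))
        = complex_of_real ((sqrt (\<Sum>\<^sub>\<infinity>i. (norm (f i))\<^sup>2))\<^sup>2)"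
      by (simp add: cinner_self infsum_nonneg infsumI del: of_real_power)
  qed
qed

end

lemma L2_set_ell2_le: "finite F \<Longrightarrow> L2_set (\<lambda>i. norm (ell2_nth f i)) F \<le> norm f"
  by transfer (simp add: ell2_L2_le)

lemma norm_ell2_nth_le: "norm (ell2_nth f i) \<le> norm f"
  using L2_set_ell2_le[of "{i}" f] by simp

lemma norm_ell2_le:
  "(\<And>F. finite F \<Longrightarrow> L2_set (\<lambda>i. norm (ell2_nth f i)) F \<le> C) \<Longrightarrow> norm f \<le> C"
  by transfer (rule L2_bounded_imp_ell2)

lemma ell2_nth_simps [simp]:
  "ell2_nth 0 i = 0"
  "ell2_nth (f + g) i = ell2_nth f i + ell2_nth g i"
  "ell2_nth (f - g) i = ell2_nth f i - ell2_nth g i"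
  "ell2_nth (- f) i = - ell2_nth f i"
  "ell2_nth (r *\<^sub>R f) i = r *\<^sub>R ell2_nth f i"
  "ell2_nth (c *\<^sub>C f) i = c *\<^sub>C ell2_nth f i"
  by (transfer, simp)+

instance ell2 :: (type, chilbert_space) chilbert_space
proof
  fix X :: "nat \<Rightarrow> ('a, 'b) ell2"
  assume X: "Cauchy X"
  have "Cauchy (\<lambda>n. ell2_nth (X n) i)" for i
  proof (rule CauchyI)
    fix e :: real
    assume "0 < e"
    then obtain M where "\<forall>m\<ge>M. \<forall>n\<ge>M. norm (X m - X n) < e"
      using X CauchyD by blast
    then show "\<exists>M. \<forall>m\<ge>M. \<forall>n\<ge>M. norm (ell2_nth (X m) i - ell2_nth (X n) i) < e"
      using norm_ell2_nth_le[of "X _ - X _" i] by (metis ell2_nth_simps(3) order_le_less_trans)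
  qed
  then have "\<forall>i. \<exists>l. (\<lambda>n. ell2_nth (X n) i) \<longlonglongrightarrow> l"
    by (meson Cauchy_convergent convergentD)
  then obtain g where g: "\<And>i. (\<lambda>n. ell2_nth (X n) i) \<longlonglongrightarrow> g i"
    by metis
  have diff: "L2_set (\<lambda>i. norm (ell2_nth (X m) i - g i)) F \<le> e"
    if "finite F" and e: "\<forall>n\<ge>M. norm (X m - X n) \<le> e" for F e m M
  proof (rule Lim_bounded)
    show "(\<lambda>n. L2_set (\<lambda>i. norm (ell2_nth (X m - X n) i)) F)
        \<longlonglongrightarrow> L2_set (\<lambda>i. norm (ell2_nth (X m) i - g i)) F"
      unfolding L2_set_def ell2_nth_simps by (intro tendsto_intros g)
    show "\<forall>n\<ge>M. L2_set (\<lambda>i. norm (ell2_nth (X m - X n) i)) F \<le> e"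
      using L2_set_ell2_le[OF \<open>finite F\<close>] e by (blast intro: order_trans)
  qed
  obtain M1 where M1: "\<forall>m\<ge>M1. \<forall>n\<ge>M1. norm (X m - X n) < 1"
    using X CauchyD[of X 1] by auto
  have "(\<lambda>i. (norm (ell2_nth (X M1) i - g i))\<^sup>2) summable_on UNIV"
    by (rule L2_bounded_imp_ell2(1)[where C=1], rule diff[where M=M1])
      (use M1 in \<open>auto simp: less_imp_le\<close>)
  moreover have "(\<lambda>i. (norm (ell2_nth (- X M1) i))\<^sup>2) summable_on UNIV"
    using ell2_nth[of "- X M1"] by simp
  ultimately have "(\<lambda>i. (norm (ell2_nth (X M1) i - g i + ell2_nth (- X M1) i))\<^sup>2) summable_on UNIV"
    by (rule ell2_add(1))
  then have "(\<lambda>i. (norm (g i))\<^sup>2) summable_on UNIV"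
    by simp
  then have nth: "ell2_nth (Abs_ell2 g) = g"
    by (simp add: Abs_ell2_inverse)
  have "X \<longlonglongrightarrow> Abs_ell2 g"
  proof (rule LIMSEQ_I)
    fix e :: real
    assume "0 < e"
    then obtain M where M: "\<forall>m\<ge>M. \<forall>n\<ge>M. norm (X m - X n) < e / 2"
      using X CauchyD[of X "e / 2"] by auto
    have "norm (X m - Abs_ell2 g) \<le> e / 2" if "m \<ge> M" for m
      by (rule norm_ell2_le, simp only: ell2_nth_simps nth, rule diff[where M=M])
        (use M that in \<open>auto simp: less_imp_le\<close>)
    with \<open>0 < e\<close> show "\<exists>M. \<forall>m\<ge>M. norm (X m - Abs_ell2 g) < e"
      by (intro exI[of _ M]) (smt (verit) field_sum_of_halves)
  qed
  then show "convergent X"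
    by (rule convergentI)
qed


section \<open>Bounded operators\<close>

definition cblin :: "('a::complex_inner \<Rightarrow>\<^sub>L 'b::complex_inner) set" where
  "cblin = {A :: 'a \<Rightarrow>\<^sub>L 'b. \<forall>c x. A (c *\<^sub>C x) = c *\<^sub>C A x}"

definition adj :: "('a::chilbert_space \<Rightarrow>\<^sub>L 'b::chilbert_space) \<Rightarrow> 'b \<Rightarrow>\<^sub>L 'a" where
  "adj A = (THE A' :: 'b \<Rightarrow>\<^sub>L 'a. \<forall>x y. cinner (A x) y = cinner x (A' y))"

definition positive_op :: "('a::complex_inner \<Rightarrow>\<^sub>L 'a) \<Rightarrow> bool" where
  "positive_op A \<longleftrightarrow> A \<in> cblin \<and> (\<forall>x. cinner (A x) x \<in> \<real> \<and> 0 \<le> Re (cinner (A x) x))"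

definition boundedly_invertible :: "('a::complex_inner \<Rightarrow>\<^sub>L 'b::complex_inner) \<Rightarrow> bool" where
  "boundedly_invertible A \<longleftrightarrow> (\<exists>A'\<in>cblin. A' o\<^sub>L A = id_blinfun \<and> A o\<^sub>L A' = id_blinfun)"

lift_definition coord :: "'i \<Rightarrow> ('i, 'a::complex_inner) ell2 \<Rightarrow>\<^sub>L 'a" is "\<lambda>i f. ell2_nth f i"
  by (rule bounded_linear_intro[where K=1]) (auto simp: norm_ell2_nth_le)

lemma ell2_pointwise:
  fixes A :: "'a::complex_inner \<Rightarrow>\<^sub>L 'b::complex_inner"
  shows "(\<lambda>i. (norm (A (ell2_nth f i)))\<^sup>2) summable_on UNIV"
    "norm (Abs_ell2 (\<lambda>i. A (ell2_nth f i))) \<le> norm A * norm f"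
proof -
  have *: "L2_set (\<lambda>i. norm (A (ell2_nth f i))) F \<le> norm A * norm f" if "finite F" for F
  proof -
    have "L2_set (\<lambda>i. norm (A (ell2_nth f i))) F \<le> L2_set (\<lambda>i. norm A * norm (ell2_nth f i)) F"
      by (rule L2_set_mono) (auto intro: norm_blinfun)
    also have "\<dots> = norm A * L2_set (\<lambda>i. norm (ell2_nth f i)) F"
      by (simp add: L2_set_right_distrib)
    also have "\<dots> \<le> norm A * norm f"
      by (simp add: L2_set_ell2_le that mult_left_mono)
    finally show ?thesis .
  qed
  show s: "(\<lambda>i. (norm (A (ell2_nth f i)))\<^sup>2) summable_on UNIV"
    using * by (rule L2_bounded_imp_ell2)
  show "norm (Abs_ell2 (\<lambda>i. A (ell2_nth f i))) \<le> norm A * norm f"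
    by (rule norm_ell2_le) (use * s in \<open>simp add: Abs_ell2_inverse\<close>)
qed

lift_definition diag :: "('a::complex_inner \<Rightarrow>\<^sub>L 'b::complex_inner) \<Rightarrow> ('i, 'a) ell2 \<Rightarrow>\<^sub>L ('i, 'b) ell2"
  is "\<lambda>A f. Abs_ell2 (\<lambda>i. blinfun_apply A (ell2_nth f i))"
  subgoal for A
  proof (rule bounded_linear_intro[where K="norm A"])
    have nth: "ell2_nth (Abs_ell2 (\<lambda>i. A (ell2_nth f i))) i = A (ell2_nth f i)"
      for f :: "('i, 'a) ell2" and i
      by (simp add: Abs_ell2_inverse ell2_pointwise)
    fix f g :: "('i, 'a) ell2" and r :: real
    show "Abs_ell2 (\<lambda>i. A (ell2_nth (f + g) i))
        = Abs_ell2 (\<lambda>i. A (ell2_nth f i)) + Abs_ell2 (\<lambda>i. A (ell2_nth g i))"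
      using nth[of "f + g"] nth[of f] nth[of g] by (intro ell2_eqI) (simp add: blinfun.add_right)
    show "Abs_ell2 (\<lambda>i. A (ell2_nth (r *\<^sub>R f) i)) = r *\<^sub>R Abs_ell2 (\<lambda>i. A (ell2_nth f i))"
      using nth[of "r *\<^sub>R f"] nth[of f] by (intro ell2_eqI) (simp add: blinfun.scaleR_right)
    show "norm (Abs_ell2 (\<lambda>i. A (ell2_nth f i))) \<le> norm f * norm A"
      by (metis ell2_pointwise(2) mult.commute)
  qed
  done

lemma ell2_nth_Abs_finite: "ell2_nth (Abs_ell2 f) i = f (i::'i::finite)"
  by (simp add: Abs_ell2_inverse)

lift_definition op_matrix ::
  "('i::finite \<Rightarrow> 'j::finite \<Rightarrow> ('a::complex_inner \<Rightarrow>\<^sub>L 'b::complex_inner))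
    \<Rightarrow> ('j, 'a) ell2 \<Rightarrow>\<^sub>L ('i, 'b) ell2"
  is "\<lambda>A f. Abs_ell2 (\<lambda>i. \<Sum>j\<in>UNIV. blinfun_apply (A i j) (ell2_nth f j))"
  subgoal for A
  proof (rule bounded_linear_intro[where K="\<Sum>i\<in>UNIV. \<Sum>j\<in>UNIV. norm (A i j)"])
    fix f g :: "('j, 'a) ell2" and r :: real
    show "Abs_ell2 (\<lambda>i. \<Sum>j\<in>UNIV. A i j (ell2_nth (f + g) j)) =
        Abs_ell2 (\<lambda>i. \<Sum>j\<in>UNIV. A i j (ell2_nth f j)) + Abs_ell2 (\<lambda>i. \<Sum>j\<in>UNIV. A i j (ell2_nth g j))"
      by (rule ell2_eqI) (simp add: ell2_nth_Abs_finite blinfun.bilinear_simps sum.distrib)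
    show "Abs_ell2 (\<lambda>i. \<Sum>j\<in>UNIV. A i j (ell2_nth (r *\<^sub>R f) j)) =
        r *\<^sub>R Abs_ell2 (\<lambda>i. \<Sum>j\<in>UNIV. A i j (ell2_nth f j))"
      by (rule ell2_eqI) (simp add: ell2_nth_Abs_finite blinfun.bilinear_simps scaleR_sum_right)
    have "L2_set (\<lambda>i. norm (\<Sum>j\<in>UNIV. A i j (ell2_nth f j))) F
        \<le> norm f * (\<Sum>i\<in>UNIV. \<Sum>j\<in>UNIV. norm (A i j))" for F
    proof -
      have "L2_set (\<lambda>i. norm (\<Sum>j\<in>UNIV. A i j (ell2_nth f j))) F
          \<le> (\<Sum>i\<in>F. norm (\<Sum>j\<in>UNIV. A i j (ell2_nth f j)))"
        by (rule L2_set_le_sum) simp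
      also have "\<dots> \<le> (\<Sum>i\<in>UNIV. norm (\<Sum>j\<in>UNIV. A i j (ell2_nth f j)))"
        by (rule sum_mono2) auto
      also have "\<dots> \<le> (\<Sum>i\<in>UNIV. \<Sum>j\<in>UNIV. norm (A i j) * norm f)"
        by (intro sum_mono sum_norm_le order_trans[OF norm_blinfun] mult_left_mono norm_ell2_nth_le) auto
      also have "\<dots> = norm f * (\<Sum>i\<in>UNIV. \<Sum>j\<in>UNIV. norm (A i j))"
        by (simp add: sum_distrib_left mult.commute)
      finally show ?thesis .
    qed
    then show "norm (Abs_ell2 (\<lambda>i. \<Sum>j\<in>UNIV. A i j (ell2_nth f j)))
        \<le> norm f * (\<Sum>i\<in>UNIV. \<Sum>j\<in>UNIV. norm (A i j))"
      by (intro norm_ell2_le) (simp add: ell2_nth_Abs_finite)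
  qed
  done


section \<open>Point evaluation on the upper triangular algebra\<close>

text \<open>The generators of the free semigroup are the elements of a finite type \<open>'n\<close>, so that
  \<open>N\<close> is \<open>CARD('n)\<close>, and words are lists over \<open>'n\<close>. The space \<open>\<Oplus>\<^sub>k \<E>\<^sub>k\<close> is \<open>('n list, 'e) ell2\<close>,
  with \<open>\<E>\<^sub>k\<close> the subspace of vectors supported on words of length \<open>k\<close>. Since summands are labelled by
  words rather than by their position, no ordering of \<open>'n\<close> is needed.\<close>

definition row_gram :: "('n::finite \<Rightarrow> 'e::chilbert_space \<Rightarrow>\<^sub>L 'e) \<Rightarrow> 'e \<Rightarrow>\<^sub>L 'e" where
  "row_gram Z = (\<Sum>k\<in>UNIV. adj (Z k) o\<^sub>L Z k)"

definition op_ball :: "('n::finite \<Rightarrow> 'e::chilbert_space \<Rightarrow>\<^sub>L 'e) set" where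
  "op_ball = {Z. range Z \<subseteq> cblin \<and> positive_op (id_blinfun - row_gram Z)
    \<and> boundedly_invertible (id_blinfun - row_gram Z)}"

primrec word_adj :: "('n \<Rightarrow> 'e::chilbert_space \<Rightarrow>\<^sub>L 'e) \<Rightarrow> 'n list \<Rightarrow> 'e \<Rightarrow>\<^sub>L 'e" where
  "word_adj Z [] = id_blinfun"
| "word_adj Z (i # \<sigma>) = adj (Z i) o\<^sub>L word_adj Z \<sigma>"

text \<open>The function below is a bounded operator whenever \<open>Z\<close> lies in the ball, the only case
  in which it is used.\<close>

definition row_op ::
    "('n::finite \<Rightarrow> 'e::chilbert_space \<Rightarrow>\<^sub>L 'e) \<Rightarrow> ('n list, 'e) ell2 \<Rightarrow>\<^sub>L 'e" where
  "row_op Z = Blinfun (\<lambda>f. \<Sum>\<^sub>\<infinity>\<sigma>. word_adj Z \<sigma> (ell2_nth f \<sigma>))"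

lift_definition level_part :: "nat \<Rightarrow> ('n list, 'e::complex_inner) ell2 \<Rightarrow> ('n list, 'e) ell2"
  is "\<lambda>k f \<sigma>. if length \<sigma> = k then f \<sigma> else 0"
  subgoal for k f by (rule summable_on_comparison_test[of "\<lambda>\<sigma>. (norm (f \<sigma>))\<^sup>2"]) auto
  done

text \<open>The matrix entry \<open>T\<^sub>i\<^sub>j\<close>, extended by zero to an operator on the whole of \<open>\<Oplus>\<^sub>k \<E>\<^sub>k\<close>.\<close>

definition block :: "(('n list, 'e::complex_inner) ell2 \<Rightarrow>\<^sub>L ('n list, 'e) ell2) \<Rightarrow> nat \<Rightarrow> nat
    \<Rightarrow> ('n list, 'e) ell2 \<Rightarrow> ('n list, 'e) ell2" where
  "block T i j = (\<lambda>f. level_part i (T (level_part j f)))"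

text \<open>The component in the copy of \<open>\<E>\<^sub>k\<^sub>-\<^sub>1\<close> with outermost index \<open>a\<close> of a vector of
  \<open>\<E>\<^sub>k = \<E>\<^sub>k\<^sub>-\<^sub>1\<^sup>\<oplus>\<^sup>N\<close>; the component \<open>\<E>\<^sub>0\<close> is discarded.\<close>

lift_definition summand :: "'n \<Rightarrow> ('n list, 'e::complex_inner) ell2 \<Rightarrow> ('n list, 'e) ell2"
  is "\<lambda>a f \<sigma>. f (a # \<sigma>)"
  subgoal for a f
    using summable_on_subset_banach[of "\<lambda>\<sigma>. (norm (f \<sigma>))\<^sup>2" UNIV "range ((#) a)"]
    by (auto simp: summable_on_reindex o_def)
  done

definition copies :: "(('n list, 'e::complex_inner) ell2 \<Rightarrow> ('n list, 'e) ell2)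
    \<Rightarrow> ('n::finite list, 'e) ell2 \<Rightarrow> ('n list, 'e) ell2" where
  "copies A f = Abs_ell2 (\<lambda>\<sigma>. case \<sigma> of [] \<Rightarrow> 0 | a # \<tau> \<Rightarrow> ell2_nth (A (summand a f)) \<tau>)"

lemma ell2_nth_copies:
  "ell2_nth (copies A f) \<sigma> = (case \<sigma> of [] \<Rightarrow> 0 | a # \<tau> \<Rightarrow> ell2_nth (A (summand a f)) \<tau>)"
  for f :: "('n::finite list, 'e::complex_inner) ell2"
proof -
  let ?h = "\<lambda>\<sigma>. (norm (case \<sigma> of [] \<Rightarrow> 0 | a # \<tau> \<Rightarrow> ell2_nth (A (summand a f)) \<tau>))\<^sup>2"
  have "?h summable_on range ((#) a)" for a
    using ell2_nth[of "A (summand a f)"] by (subst summable_on_reindex) (auto simp: o_def)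
  then have "?h summable_on (\<Union>a. range ((#) a))"
    by (intro summable_on_finite_union_disjoint) auto
  moreover have "?h summable_on UNIV \<longleftrightarrow> ?h summable_on (\<Union>a. range ((#) a))"
    by (rule summable_on_cong_neutral) (auto split: list.splits)
  ultimately show ?thesis
    by (simp add: copies_def Abs_ell2_inverse)
qed

definition upper_tri :: "(('n::finite list, 'e::complex_inner) ell2 \<Rightarrow>\<^sub>L ('n list, 'e) ell2) set" where
  "upper_tri = {T \<in> cblin. (\<forall>i j. j < i \<longrightarrow> block T i j = (\<lambda>_. 0)) \<and>
    (\<forall>i j. 1 \<le> i \<and> i \<le> j \<longrightarrow> block T i j = copies (block T (i - 1) (j - 1)))}"

definition schur_class :: "(('n::finite list, 'e::complex_inner) ell2 \<Rightarrow>\<^sub>L ('n list, 'e) ell2) set" where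
  "schur_class = {T \<in> upper_tri. norm T \<le> 1}"

definition point_eval :: "(('n::finite list, 'e::chilbert_space) ell2 \<Rightarrow>\<^sub>L ('n list, 'e) ell2)
    \<Rightarrow> ('n \<Rightarrow> 'e \<Rightarrow>\<^sub>L 'e) \<Rightarrow> 'e \<Rightarrow>\<^sub>L 'e" where
  "point_eval T Z = coord [] o\<^sub>L T o\<^sub>L adj (row_op Z)"

definition pick_matrix :: "('m::finite \<Rightarrow> 'n::finite \<Rightarrow> 'e::chilbert_space \<Rightarrow>\<^sub>L 'e)
    \<Rightarrow> ('m \<Rightarrow> 'e \<Rightarrow>\<^sub>L 'e) \<Rightarrow> ('m, 'e) ell2 \<Rightarrow>\<^sub>L ('m, 'e) ell2" where
  "pick_matrix Z B = op_matrix (\<lambda>j k.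
    row_op (Z j) o\<^sub>L diag (id_blinfun - (adj (B j) o\<^sub>L B k)) o\<^sub>L adj (row_op (Z k)))"

end

theory Submission
  imports Defs
begin

text \<open>The operators in the upper triangular algebra are exactly those commuting with the backward
  shifts \<open>f \<mapsto> summand a f\<close>, and the vectors \<open>adj (row_op Z) x\<close> behave like eigenvectors:
  the backward shifts send them to \<open>adj (row_op Z) (Z a x)\<close>. Hence \<open>point_eval T (Z k) = B k\<close> holds
  iff \<open>T\<close> agrees on the range of \<open>adj (row_op (Z k))\<close> with \<open>diag (B k)\<close>, and positivity of the Pick
  matrix says that \<open>diag (B k)\<close> on these ranges gives a well-defined contraction \<open>R\<close> on their linear span
  \<open>M\<close>. Both \<open>M\<close> and \<open>R\<close> are compatible with the backward shifts, so it remains to extend \<open>R\<close>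
  to a contraction on the whole space that still commutes with them (noncommutative commutant lifting).
  This is done one level at a time: on the vectors all of whose backward shifts lie in the current domain,
  only the coordinate at the empty word is free, and it is obtained by extending a contraction from
  a subspace of a semi-inner product space. The union of the domains contains all vectors supported on
  words of bounded length, hence is dense.\<close>

section \<open>Semi-inner products\<close>

text \<open>For \<open>q > 0\<close> the value \<open>r = 1 / q\<close> gives the claim; for
  \<open>q = 0\<close> the expression is affine in \<open>r\<close> and would become negative if
  \<open>G > 0\<close>. In the applications \<open>G\<close> is a squared modulus whose phase is
  absorbed into a test vector, so one real parameter suffices.\<close>

lemma quadratic_nonneg_imp_le:
  fixes G q d :: real
  assumes "0 \<le> q" and quad: "\<And>r. 0 \<le> r\<^sup>2 * G * q - 2 * r * G + d"
  shows "G \<le> d * q"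
proof (cases "q = 0")
  case True
  have "G \<le> 0"
  proof (rule ccontr)
    assume "\<not> G \<le> 0"
    then have "0 \<le> - (d + 1) + d"
      using quad[of "(d + 1) / (2 * G)"] True by simp
    then show False by simp
  qed
  then show ?thesis using True by simp
next
  case False
  then have "0 < q" using assms by simp
  have "0 \<le> G / q - 2 * (G / q) + d"
    using quad[of "1 / q"] \<open>0 < q\<close> by (simp add: power2_eq_square)
  then have "G / q \<le> d" by simp
  then show ?thesis
    using \<open>0 < q\<close> by (simp add: pos_divide_le_eq)
qed

text \<open>Closedness is not imposed: the spans and increasing unions met below need not be
  closed.\<close>

definition csubspace :: "'a::complex_inner set \<Rightarrow> bool" where
  "csubspace M \<longleftrightarrow> 0 \<in> M \<and> (\<forall>x\<in>M. \<forall>y\<in>M. x + y \<in> M) \<and> (\<forall>c. \<forall>x\<in>M. c *\<^sub>C x \<in> M)"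

definition clinear_on :: "'a::complex_inner set \<Rightarrow> ('a \<Rightarrow> 'b::complex_inner) \<Rightarrow> bool" where
  "clinear_on M f \<longleftrightarrow> (\<forall>x\<in>M. \<forall>y\<in>M. f (x + y) = f x + f y) \<and> (\<forall>c. \<forall>x\<in>M. f (c *\<^sub>C x) = c *\<^sub>C f x)"

lemma scaleC_minus_one: "(- 1) *\<^sub>C x = - (x::'a::complex_inner)"
  using scaleC_of_real[of "-1" x] by simp

lemma csubspace_diff: "csubspace M \<Longrightarrow> x \<in> M \<Longrightarrow> y \<in> M \<Longrightarrow> x - y \<in> M"
  unfolding csubspace_def by (metis diff_conv_add_uminus scaleC_minus_one)

lemma clinear_on_diff:
  "clinear_on M f \<Longrightarrow> csubspace M \<Longrightarrow> x \<in> M \<Longrightarrow> y \<in> M \<Longrightarrow> f (x - y) = f x - f y"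
  unfolding clinear_on_def csubspace_def
  by (metis diff_conv_add_uminus scaleC_minus_one)

lemma clinear_onD:
  assumes "clinear_on M f"
  shows "x \<in> M \<Longrightarrow> y \<in> M \<Longrightarrow> f (x + y) = f x + f y" "x \<in> M \<Longrightarrow> f (c *\<^sub>C x) = c *\<^sub>C f x"
  using assms by (auto simp: clinear_on_def)

lemma csubspaceD:
  assumes "csubspace M"
  shows "0 \<in> M" "x \<in> M \<Longrightarrow> y \<in> M \<Longrightarrow> x + y \<in> M" "x \<in> M \<Longrightarrow> c *\<^sub>C x \<in> M"
  using assms by (auto simp: csubspace_def)

locale semi_inner =
  fixes Q :: "'a::complex_inner \<Rightarrow> 'a \<Rightarrow> complex"
  assumes Q_add_left: "Q (x + y) z = Q x z + Q y z"
    and Q_scaleC_left: "Q (c *\<^sub>C x) y = c * Q x y"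
    and Q_commute: "Q x y = cnj (Q y x)"
    and Q_nonneg: "0 \<le> Re (Q x x)"
begin

abbreviation q :: "'a \<Rightarrow> real" where "q x \<equiv> Re (Q x x)"

lemma Q_add_right: "Q x (y + z) = Q x y + Q x z"
  by (metis Q_add_left Q_commute complex_cnj_add)

lemma Q_scaleC_right: "Q x (c *\<^sub>C y) = cnj c * Q x y"
  by (metis Q_scaleC_left Q_commute complex_cnj_mult)

lemma Q_minus_left: "Q (- x) y = - Q x y"
  using Q_scaleC_left[of "-1" x y] by (simp add: scaleC_minus_one)

lemma Q_minus_right: "Q x (- y) = - Q x y"
  using Q_scaleC_right[of x "-1" y] by (simp add: scaleC_minus_one)

lemma Q_diff_right: "Q x (y - z) = Q x y - Q x z"
  by (metis Q_add_right Q_minus_right diff_conv_add_uminus)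

lemma Q_zero [simp]: "Q x 0 = 0" "Q 0 x = 0"
  using Q_add_right[of x 0 0] Q_add_left[of 0 0 x] by auto

lemma q_add_scaleC: "q (x + t *\<^sub>C k) = q x + (cmod t)\<^sup>2 * q k + 2 * Re (t * Q k x)"
proof -
  have "Q (x + t *\<^sub>C k) (x + t *\<^sub>C k)
      = Q x x + t * cnj t * Q k k + (t * Q k x + cnj (t * Q k x))"
    using Q_commute[of x k]
    by (simp add: Q_add_left Q_add_right Q_scaleC_left Q_scaleC_right algebra_simps)
  also have "t * cnj t = complex_of_real ((cmod t)\<^sup>2)"
    by (rule complex_norm_square[symmetric])
  finally show ?thesis
    by (simp del: of_real_power)
qed

text \<open>A vector that almost minimises \<open>q x - 2 Re (\<phi> x)\<close> almost represents \<open>\<phi>\<close>.\<close>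

lemma near_minimizer:
  assumes min: "\<And>t. q s - 2 * Re (\<phi> s) - d \<le> q (s + t *\<^sub>C k) - 2 * Re (\<phi> s + t * \<phi> k)"
  shows "cmod (\<phi> k - Q k s) \<le> sqrt d * sqrt (q k)"
proof -
  define g where "g = Q k s - \<phi> k"
  have "(cmod g)\<^sup>2 \<le> d * q k"
  proof (rule quadratic_nonneg_imp_le[OF Q_nonneg])
    fix r :: real
    \<comment> \<open>The factor \<open>cnj g\<close> cancels the phase: the linear term becomes a
      real multiple of the squared modulus of \<open>g\<close>, which is the shape of the quadratic
      criterion.\<close>
    define t where "t = - (r * cnj g)"
    have "0 \<le> (cmod t)\<^sup>2 * q k + 2 * (Re (t * Q k s) - Re (t * \<phi> k)) + d"
      using min[of t] unfolding q_add_scaleC plus_complex.sel by argo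
    moreover have "Re (t * Q k s) - Re (t * \<phi> k) = Re (t * g)"
      by (simp add: g_def algebra_simps)
    moreover have "Re (t * g) = - r * (cmod g)\<^sup>2"
      by (simp add: t_def cmod_def power2_eq_square algebra_simps)
    moreover have "(cmod t)\<^sup>2 = r\<^sup>2 * (cmod g)\<^sup>2"
      by (simp add: t_def norm_mult power_mult_distrib)
    ultimately show "0 \<le> r\<^sup>2 * (cmod g)\<^sup>2 * q k - 2 * r * (cmod g)\<^sup>2 + d"
      by simp
  qed
  then have "cmod g \<le> sqrt (d * q k)"
    by (rule real_le_rsqrt)
  then show ?thesis
    by (simp add: g_def real_sqrt_mult norm_minus_commute)
qed

text \<open>Nonnegativity of \<open>q\<close> along the line from \<open>y\<close> in direction
  \<open>- cnj (Q x y)\<close> times \<open>x\<close> is a quadratic condition in \<open>r\<close>.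
  The criterion also covers \<open>q x = 0\<close>, where one cannot divide by
  \<open>q x\<close>.\<close>

lemma Q_Cauchy_Schwarz: "cmod (Q x y) \<le> sqrt (q x) * sqrt (q y)"
proof -
  have "(cmod (Q x y))\<^sup>2 \<le> q y * q x"
  proof (rule quadratic_nonneg_imp_le[OF Q_nonneg])
    fix r :: real
    have "Re (- (r * cnj (Q x y)) * Q x y) = - r * (cmod (Q x y))\<^sup>2"
      by (simp add: cmod_def power2_eq_square algebra_simps)
    then show "0 \<le> r\<^sup>2 * (cmod (Q x y))\<^sup>2 * q x - 2 * r * (cmod (Q x y))\<^sup>2 + q y"
      using Q_nonneg[of "y + (- (r * cnj (Q x y))) *\<^sub>C x"] unfolding q_add_scaleC
      by (simp add: norm_mult power_mult_distrib del: mult_minus_left)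
  qed
  then have "cmod (Q x y) \<le> sqrt (q y * q x)"
    by (rule real_le_rsqrt)
  then show ?thesis
    by (simp add: real_sqrt_mult mult.commute)
qed

text \<open>The usual variational proof, stopped before the limit: \<open>J\<close> is bounded below
  on \<open>M\<close>, and a vector within \<open>1 / Suc n\<close> of its infimum represents
  \<open>\<phi>\<close> up to the square root of that error. Hence \<open>M\<close> may be
  incomplete.\<close>

lemma approx_Riesz:
  assumes M: "csubspace M" and \<phi>: "clinear_on M \<phi>"
    and bound: "\<And>x. x \<in> M \<Longrightarrow> cmod (\<phi> x) \<le> c * sqrt (q x)"
  obtains s where "\<And>n. s n \<in> M"
    "\<And>n k. k \<in> M \<Longrightarrow> cmod (\<phi> k - Q k (s n)) \<le> sqrt (1 / real (Suc n)) * sqrt (q k)"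
proof -
  define J where "J x = q x - 2 * Re (\<phi> x)" for x
  have below: "- (c\<^sup>2) \<le> J x" if "x \<in> M" for x
  proof -
    have "Re (\<phi> x) \<le> c * sqrt (q x)"
      using bound[OF that] complex_Re_le_cmod order_trans by blast
    \<comment> \<open>Completing the square yields the lower bound.\<close>
    moreover have "0 \<le> (sqrt (q x) - c)\<^sup>2"
      by simp
    ultimately show ?thesis
      using Q_nonneg[of x] by (simp add: J_def power2_diff algebra_simps)
  qed
  then have bdd: "bdd_below (J ` M)"
    by (auto intro!: bdd_belowI2)
  define I where "I = Inf (J ` M)"
  have "\<exists>s\<in>M. J s < I + 1 / real (Suc n)" for n
  proof -
    have "J ` M \<noteq> {}"
      using csubspaceD(1)[OF M] by auto
    then show ?thesis
      using cInf_lessD[of "J ` M" "I + 1 / real (Suc n)"] by (auto simp: I_def)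
  qed
  then obtain s where s: "\<And>n. s n \<in> M" "\<And>n. J (s n) < I + 1 / real (Suc n)"
    by metis
  show ?thesis
  proof (rule that[OF s(1)])
    fix n k
    assume k: "k \<in> M"
    show "cmod (\<phi> k - Q k (s n)) \<le> sqrt (1 / real (Suc n)) * sqrt (q k)"
    proof (rule near_minimizer)
      fix t
      have "I \<le> J (s n + t *\<^sub>C k)"
        unfolding I_def by (intro cINF_lower bdd csubspaceD[OF M] s k)
      moreover have "\<phi> (s n + t *\<^sub>C k) = \<phi> (s n) + t * \<phi> k"
        using clinear_onD[OF \<phi>] csubspaceD[OF M] s k by (simp add: scaleC_complex_def)
      ultimately show "q (s n) - 2 * Re (\<phi> (s n)) - 1 / real (Suc n)
          \<le> q (s n + t *\<^sub>C k) - 2 * Re (\<phi> (s n) + t * \<phi> k)"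
        using s(2)[of n] unfolding J_def by simp
    qed
  qed
qed

section \<open>Projection onto an incomplete subspace, and extension of contractions\<close>

lemma self_bound:
  assumes "cmod (Q x x) \<le> e * sqrt (q x)"
  shows "sqrt (q x) \<le> \<bar>e\<bar>"
\<comment> \<open>A factor \<open>sqrt (q x)\<close> is cancelled when it is nonzero. The absolute
  value serves the case \<open>q x = 0\<close>, where \<open>e\<close> may be negative.\<close>
proof (cases "q x = 0")
  case False
  then have pos: "0 < sqrt (q x)"
    using Q_nonneg[of x] by simp
  have "sqrt (q x) * sqrt (q x) \<le> e * sqrt (q x)"
    using assms complex_Re_le_cmod[of "Q x x"] Q_nonneg[of x] by simp
  then have "sqrt (q x) \<le> e"
    using pos by (rule mult_right_le_imp_le)
  then show ?thesis
    by simp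
qed simp

text \<open>\<open>approximates M v s\<close> says that \<open>s\<close> converges, up to vectors of length zero, to the
  orthogonal projection of \<open>v\<close> onto the completion of \<open>M\<close>. Working with sequences avoids constructing
  the quotient by the null space of \<open>q\<close> and its completion.\<close>

definition approximates :: "'a set \<Rightarrow> 'a \<Rightarrow> (nat \<Rightarrow> 'a) \<Rightarrow> bool" where
  "approximates M v s \<longleftrightarrow> (\<forall>n. s n \<in> M) \<and>
    (\<exists>e. e \<longlonglongrightarrow> (0::real) \<and> (\<forall>n. \<forall>k\<in>M. cmod (Q k v - Q k (s n)) \<le> e n * sqrt (q k)))"

text \<open>By Cauchy-Schwarz, pairing with \<open>v\<close> is a bounded functional on
  \<open>M\<close>; its approximate representers form the sequence.\<close>

lemma approximates_exists:
  assumes "csubspace M"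
  shows "\<exists>s. approximates M v s"
proof -
  have "clinear_on M (\<lambda>k. Q k v)"
    by (simp add: clinear_on_def Q_add_left Q_scaleC_left scaleC_complex_def)
  moreover have "cmod (Q k v) \<le> sqrt (q v) * sqrt (q k)" for k
    using Q_Cauchy_Schwarz[of k v] by (simp add: mult.commute)
  ultimately obtain s where s: "\<And>n. s n \<in> M"
    "\<And>n k. k \<in> M \<Longrightarrow> cmod (Q k v - Q k (s n)) \<le> sqrt (1 / real (Suc n)) * sqrt (q k)"
    using approx_Riesz[OF assms] by blast
  have "(\<lambda>n. sqrt (1 / real (Suc n))) \<longlonglongrightarrow> 0"
    using tendsto_real_sqrt[OF LIMSEQ_Suc[OF lim_1_over_n]] by simp
  then show ?thesis
    using s unfolding approximates_def
    by (intro exI[of _ s] conjI exI[of _ "\<lambda>n. sqrt (1 / real (Suc n))"]) auto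
qed

lemma approximates_const: "v \<in> M \<Longrightarrow> approximates M v (\<lambda>_. v)"
  by (auto simp: approximates_def intro!: exI[of _ "\<lambda>_. 0"])

lemma approximates_add:
  assumes M: "csubspace M" and "approximates M v s" "approximates M w t"
  shows "approximates M (v + w) (\<lambda>n. s n + t n)"
proof -
  obtain e where e: "e \<longlonglongrightarrow> 0" "\<And>n. s n \<in> M"
      "\<And>n k. k \<in> M \<Longrightarrow> cmod (Q k v - Q k (s n)) \<le> e n * sqrt (q k)"
    using assms(2) unfolding approximates_def by metis
  obtain f where f: "f \<longlonglongrightarrow> 0" "\<And>n. t n \<in> M"
      "\<And>n k. k \<in> M \<Longrightarrow> cmod (Q k w - Q k (t n)) \<le> f n * sqrt (q k)"
    using assms(3) unfolding approximates_def by metis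
  have "cmod (Q k (v + w) - Q k (s n + t n)) \<le> (e n + f n) * sqrt (q k)" if "k \<in> M" for n k
  proof -
    have "Q k (v + w) - Q k (s n + t n) = (Q k v - Q k (s n)) + (Q k w - Q k (t n))"
      by (simp add: Q_add_right)
    then show ?thesis
      using norm_triangle_ineq[of "Q k v - Q k (s n)" "Q k w - Q k (t n)"]
        e(3)[OF that, of n] f(3)[OF that, of n] by (simp add: distrib_right)
  qed
  moreover have "(\<lambda>n. e n + f n) \<longlonglongrightarrow> 0"
    using tendsto_add[OF e(1) f(1)] by simp
  ultimately show ?thesis
    using assms csubspaceD[OF M] unfolding approximates_def
    by (intro conjI exI[of _ "\<lambda>n. e n + f n"]) auto
qed

lemma approximates_scaleC:
  assumes M: "csubspace M" and "approximates M v s"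
  shows "approximates M (c *\<^sub>C v) (\<lambda>n. c *\<^sub>C s n)"
proof -
  obtain e where e: "e \<longlonglongrightarrow> 0" "\<And>n. s n \<in> M"
      "\<And>n k. k \<in> M \<Longrightarrow> cmod (Q k v - Q k (s n)) \<le> e n * sqrt (q k)"
    using assms(2) unfolding approximates_def by metis
  have "cmod (Q k (c *\<^sub>C v) - Q k (c *\<^sub>C s n)) \<le> (cmod c * e n) * sqrt (q k)" if "k \<in> M" for n k
  proof -
    have "Q k (c *\<^sub>C v) - Q k (c *\<^sub>C s n) = cnj c * (Q k v - Q k (s n))"
      by (simp add: Q_scaleC_right right_diff_distrib)
    then show ?thesis
      using mult_left_mono[OF e(3)[OF that, of n], of "cmod c"] by (simp add: norm_mult mult.assoc)
  qed
  moreover have "(\<lambda>n. cmod c * e n) \<longlonglongrightarrow> 0"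
    using tendsto_mult_left[OF e(1), of "cmod c"] by simp
  ultimately show ?thesis
    using assms csubspaceD[OF M] unfolding approximates_def
    by (intro conjI exI[of _ "\<lambda>n. cmod c * e n"]) auto
qed

lemma approximates_diff:
  assumes M: "csubspace M" and "approximates M v s" "approximates M w t"
  shows "approximates M (v - w) (\<lambda>n. s n - t n)"
  using approximates_add[OF M assms(2) approximates_scaleC[OF M assms(3), of "-1"]]
  by (simp add: scaleC_minus_one)

text \<open>The extension is \<open>R\<close> composed with the orthogonal projection onto the
  completion of \<open>M\<close>, realised as the limit of \<open>R (s n)\<close> for any
  \<open>s\<close> approximating \<open>v\<close>. It stays bounded by \<open>q\<close> since a
  projection does not increase length.\<close>

proposition contraction_extension:
  fixes R :: "'a \<Rightarrow> 'b::chilbert_space"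
  assumes M: "csubspace M" and R: "clinear_on M R"
    and bound: "\<And>x. x \<in> M \<Longrightarrow> (norm (R x))\<^sup>2 \<le> q x"
  obtains R' where "clinear_on UNIV R'" "\<And>x. x \<in> M \<Longrightarrow> R' x = R x" "\<And>x. (norm (R' x))\<^sup>2 \<le> q x"
proof -
  have bound': "norm (R x) \<le> sqrt (q x)" if "x \<in> M" for x
    using bound[OF that] by (simp add: real_le_rsqrt)
  \<comment> \<open>The difference \<open>s m - s n\<close> lies in \<open>M\<close>, so it may be
    used as its own test vector; this makes \<open>R (s n)\<close> Cauchy, and completeness is
    needed only in the target space.\<close>
  have conv: "convergent (\<lambda>n. R (s n))" if s: "approximates M v s" for v s
  proof -
    obtain e where e: "e \<longlonglongrightarrow> 0" and sM: "\<And>n. s n \<in> M" and e':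
      "\<And>n k. k \<in> M \<Longrightarrow> cmod (Q k v - Q k (s n)) \<le> e n * sqrt (q k)"
      using s unfolding approximates_def by metis
    have diff: "norm (R (s m) - R (s n)) \<le> \<bar>e m\<bar> + \<bar>e n\<bar>" for m n
    proof -
      let ?k = "s m - s n"
      have k: "?k \<in> M"
        using csubspace_diff[OF M] sM by blast
      have "Q ?k ?k = (Q ?k v - Q ?k (s n)) - (Q ?k v - Q ?k (s m))"
        by (simp add: Q_diff_right)
      then have "cmod (Q ?k ?k) \<le> (e n + e m) * sqrt (q ?k)"
        using norm_triangle_ineq4[of "Q ?k v - Q ?k (s n)" "Q ?k v - Q ?k (s m)"]
          e'[OF k, of n] e'[OF k, of m] by (simp add: distrib_right)
      from self_bound[OF this] bound'[OF k] show ?thesis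
        using clinear_on_diff[OF R M sM sM, of m n] by simp
    qed
    have "Cauchy (\<lambda>n. R (s n))"
    proof (rule CauchyI)
      fix d :: real
      assume "0 < d"
      then obtain N where "\<And>n. n \<ge> N \<Longrightarrow> \<bar>e n\<bar> < d / 2"
        using LIMSEQ_D[OF e, of "d / 2"] by auto
      then have "norm (R (s m) - R (s n)) < d" if "m \<ge> N" "n \<ge> N" for m n
        using diff[of m n] that by (smt (verit) field_sum_of_halves)
      then show "\<exists>N. \<forall>m\<ge>N. \<forall>n\<ge>N. norm (R (s m) - R (s n)) < d"
        by blast
    qed
    then show ?thesis
      by (rule Cauchy_convergent)
  qed
  \<comment> \<open>Two sequences approximating the same \<open>v\<close> differ by one
    approximating \<open>0\<close>, so this gives independence of the sequence chosen by
    \<open>SOME\<close> below.\<close>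
  have null: "(\<lambda>n. R (s n)) \<longlonglongrightarrow> 0" if s: "approximates M 0 s" for s
  proof -
    obtain e where e: "e \<longlonglongrightarrow> 0" and sM: "\<And>n. s n \<in> M" and e':
      "\<And>n k. k \<in> M \<Longrightarrow> cmod (Q k 0 - Q k (s n)) \<le> e n * sqrt (q k)"
      using s unfolding approximates_def by metis
    have "norm (R (s n)) \<le> \<bar>e n\<bar>" for n
      using self_bound[of "s n" "e n"] e'[OF sM, of n n] bound'[OF sM, of n] by simp
    then show ?thesis
      by (intro Lim_null_comparison[OF _ tendsto_rabs_zero[OF e]]) simp
  qed
  define R' where "R' v = lim (\<lambda>n. R ((SOME s. approximates M v s) n))" for v
  have lim: "(\<lambda>n. R (s n)) \<longlonglongrightarrow> R' v" if s: "approximates M v s" for v s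
  proof -
    define t where "t = (SOME s. approximates M v s)"
    have t: "approximates M v t"
      unfolding t_def using approximates_exists[OF M] by (rule someI_ex)
    have "(\<lambda>n. R (s n - t n)) \<longlonglongrightarrow> 0"
      using approximates_diff[OF M s t] by (intro null) simp
    moreover have "R (s n - t n) = R (s n) - R (t n)" for n
      using s t by (intro clinear_on_diff[OF R M]) (auto simp: approximates_def)
    moreover have "(\<lambda>n. R (t n)) \<longlonglongrightarrow> R' v"
      using conv[OF t] by (simp add: R'_def t_def convergent_LIMSEQ_iff)
    ultimately show ?thesis
      using tendsto_add[of "\<lambda>n. R (s n - t n)" 0 sequentially "\<lambda>n. R (t n)" "R' v"] by simp
  qed
  show ?thesis
  proof
    show "R' x = R x" if "x \<in> M" for x
      using lim[OF approximates_const[OF that]] by (simp add: LIMSEQ_const_iff)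
    show "clinear_on UNIV R'"
      unfolding clinear_on_def
    proof (intro conjI ballI allI)
      fix v w c
      obtain s t where s: "approximates M v s" and t: "approximates M w t"
        using approximates_exists[OF M] by metis
      have sM: "s n \<in> M" and tM: "t n \<in> M" for n
        using s t by (auto simp: approximates_def)
      have "(\<lambda>n. R (s n + t n)) \<longlonglongrightarrow> R' v + R' w"
        using tendsto_add[OF lim[OF s] lim[OF t]] by (simp add: clinear_onD[OF R] sM tM)
      then show "R' (v + w) = R' v + R' w"
        using lim[OF approximates_add[OF M s t]] LIMSEQ_unique by blast
      have "bounded_linear (\<lambda>x::'b. c *\<^sub>C x)"
        by (rule bounded_linear_intro[where K="cmod c"])
          (simp_all add: scaleC_add_right norm_scaleC scaleC_of_real[symmetric] scaleC_scaleC
            mult.commute)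
      from bounded_linear.tendsto[OF this lim[OF s]]
      have "(\<lambda>n. R (c *\<^sub>C s n)) \<longlonglongrightarrow> c *\<^sub>C R' v"
        by (simp add: clinear_onD[OF R] sM)
      then show "R' (c *\<^sub>C v) = c *\<^sub>C R' v"
        using lim[OF approximates_scaleC[OF M s, of c]] LIMSEQ_unique by blast
    qed
    fix v
    obtain s where s: "approximates M v s"
      using approximates_exists[OF M] by blast
    obtain e where e: "e \<longlonglongrightarrow> 0" and sM: "\<And>n. s n \<in> M" and e':
      "\<And>n k. k \<in> M \<Longrightarrow> cmod (Q k v - Q k (s n)) \<le> e n * sqrt (q k)"
      using s unfolding approximates_def by metis
    \<comment> \<open>Testing \<open>s n\<close> against itself bounds its length by that of
      \<open>v\<close> up to an error that vanishes in the limit.\<close>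
    have "norm (R (s n)) \<le> \<bar>sqrt (q v) + e n\<bar>" for n
    proof -
      have "cmod (Q (s n) (s n)) \<le> cmod (Q (s n) v) + cmod (Q (s n) v - Q (s n) (s n))"
        using norm_triangle_sub[of "Q (s n) (s n)" "Q (s n) v"]
        by (simp add: norm_minus_commute)
      also have "\<dots> \<le> (sqrt (q v) + e n) * sqrt (q (s n))"
        using Q_Cauchy_Schwarz[of "s n" v] e'[OF sM, of n n] by (simp add: algebra_simps)
      finally show ?thesis
        using self_bound bound'[OF sM, of n] order_trans by blast
    qed
    moreover have "(\<lambda>n. \<bar>sqrt (q v) + e n\<bar>) \<longlonglongrightarrow> \<bar>sqrt (q v) + 0\<bar>"
      by (intro tendsto_intros e)
    ultimately have "norm (R' v) \<le> \<bar>sqrt (q v) + 0\<bar>"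
      by (intro LIMSEQ_le[OF tendsto_norm[OF lim[OF s]]]) auto
    then have "norm (R' v) \<le> sqrt (q v)"
      using Q_nonneg[of v] by simp
    from power_mono[OF this, of 2] show "(norm (R' v))\<^sup>2 \<le> q v"
      using Q_nonneg[of v] by simp
  qed
qed

end


section \<open>Adjoints\<close>

interpretation cinner: semi_inner "cinner :: 'a::complex_inner \<Rightarrow> 'a \<Rightarrow> complex"
  by standard (simp_all add: cinner_add_left cinner_scaleC_left cinner_commute[symmetric] cinner_self)

lemma q_cinner: "Re (cinner x x) = (norm x)\<^sup>2"
  by (simp add: cinner_self)

lemma cinner_sum_left: "cinner (\<Sum>i\<in>A. f i) y = (\<Sum>i\<in>A. cinner (f i) y)"
  by (induction A rule: infinite_finite_induct) (auto simp: cinner_add_left)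

lemma cinner_sum_right: "cinner x (\<Sum>i\<in>A. f i) = (\<Sum>i\<in>A. cinner x (f i))"
  by (induction A rule: infinite_finite_induct) (auto simp: cinner_add_right)

lemma cinner_ext:
  assumes "\<And>x. cinner x y = cinner x z"
  shows "y = z"
proof -
  have "cinner (y - z) (y - z) = 0"
    using assms[of "y - z"] by (simp add: cinner.Q_diff_right)
  then show ?thesis
    by (simp add: cinner_self)
qed

lemma cblinD: "A \<in> cblin \<Longrightarrow> blinfun_apply A (c *\<^sub>C x) = c *\<^sub>C blinfun_apply A x"
  by (simp add: cblin_def)

lemma cblin_of_clinear:
  fixes f :: "'a::complex_inner \<Rightarrow> 'b::complex_inner"
  assumes f: "clinear_on UNIV f" and bound: "\<And>x. norm (f x) \<le> K * norm x"
  obtains A where "A \<in> cblin" "\<And>x. blinfun_apply A x = f x"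
proof -
  have "bounded_linear f"
  proof (rule bounded_linear_intro[where K=K])
    show "f (x + y) = f x + f y" for x y
      using clinear_onD[OF f] by simp
    show "f (r *\<^sub>R x) = r *\<^sub>R f x" for r x
      using clinear_onD(2)[OF f, of x "complex_of_real r"] by (simp add: scaleC_of_real)
    show "norm (f x) \<le> norm x * K" for x
      using bound[of x] by (simp add: mult.commute)
  qed
  then have "blinfun_apply (Blinfun f) x = f x" for x
    by (simp add: bounded_linear_Blinfun_apply)
  then show ?thesis
    using clinear_onD(2)[OF f] by (intro that[of "Blinfun f"]) (auto simp: cblin_def)
qed

text \<open>The approximate representers on the whole space form a Cauchy sequence, again by testing
  differences against themselves; completeness turns them into an exact representer.\<close>

lemma Riesz_representation:
  fixes \<phi> :: "'a::chilbert_space \<Rightarrow> complex"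
  assumes "clinear_on UNIV \<phi>" and "\<And>x. cmod (\<phi> x) \<le> c * norm x"
  obtains z where "\<And>x. \<phi> x = cinner x z"
proof -
  have "csubspace (UNIV :: 'a set)"
    by (simp add: csubspace_def)
  moreover have "cmod (\<phi> x) \<le> c * sqrt (Re (cinner x x))" for x
    using assms(2) by (simp add: q_cinner)
  ultimately obtain s :: "nat \<Rightarrow> 'a" where
    s': "\<And>n k. k \<in> UNIV \<Longrightarrow> cmod (\<phi> k - cinner k (s n)) \<le> sqrt (1 / real (Suc n)) * sqrt (Re (cinner k k))"
    using cinner.approx_Riesz[OF _ assms(1), of c] by metis
  have s: "cmod (\<phi> k - cinner k (s n)) \<le> sqrt (1 / real (Suc n)) * norm k" for n k
    using s'[of k n] by (simp add: q_cinner)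
  define e where "e n = sqrt (1 / real (Suc n))" for n
  have e: "e \<longlonglongrightarrow> 0"
    unfolding e_def using tendsto_real_sqrt[OF LIMSEQ_Suc[OF lim_1_over_n]] by simp
  have diff: "norm (s m - s n) \<le> \<bar>e m + e n\<bar>" for m n
  proof -
    let ?k = "s m - s n"
    have "cinner ?k ?k = (\<phi> ?k - cinner ?k (s n)) - (\<phi> ?k - cinner ?k (s m))"
      by (simp add: cinner.Q_diff_right)
    then have "cmod (cinner ?k ?k) \<le> (e m + e n) * norm ?k"
      using norm_triangle_ineq4[of "\<phi> ?k - cinner ?k (s n)" "\<phi> ?k - cinner ?k (s m)"]
        s[of ?k n] s[of ?k m] by (simp add: e_def distrib_right)
    then show ?thesis
      using cinner.self_bound[of ?k "e m + e n"] by (simp add: q_cinner)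
  qed
  have "Cauchy s"
  proof (rule CauchyI)
    fix d :: real
    assume "0 < d"
    then obtain N where N: "\<And>n. n \<ge> N \<Longrightarrow> \<bar>e n\<bar> < d / 2"
      using LIMSEQ_D[OF e, of "d / 2"] by auto
    have "norm (s m - s n) < d" if "m \<ge> N" "n \<ge> N" for m n
      using diff[of m n] N[OF that(1)] N[OF that(2)] by linarith
    then show "\<exists>N. \<forall>m\<ge>N. \<forall>n\<ge>N. norm (s m - s n) < d"
      by blast
  qed
  then obtain z where z: "s \<longlonglongrightarrow> z"
    using Cauchy_convergent convergentD by blast
  show ?thesis
  proof
    fix k
    have "(\<lambda>n. cinner k (s n)) \<longlonglongrightarrow> \<phi> k"
    proof (rule LIM_zero_cancel, rule Lim_null_comparison)
      show "\<forall>\<^sub>F n in sequentially. norm (cinner k (s n) - \<phi> k) \<le> e n * norm k"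
        using s[of k] by (simp add: e_def norm_minus_commute)
      show "(\<lambda>n. e n * norm k) \<longlonglongrightarrow> 0"
        using tendsto_mult_right[OF e] by simp
    qed
    moreover have "(\<lambda>n. cinner k (s n)) \<longlonglongrightarrow> cinner k z"
    proof (rule LIM_zero_cancel, rule Lim_null_comparison)
      show "\<forall>\<^sub>F n in sequentially. norm (cinner k (s n) - cinner k z) \<le> norm k * norm (s n - z)"
        by (simp add: cinner.Q_diff_right[symmetric] cmod_cinner_le)
      show "(\<lambda>n. norm k * norm (s n - z)) \<longlonglongrightarrow> 0"
        using tendsto_mult_left[OF tendsto_norm_zero[OF LIM_zero[OF z]]] by simp
    qed
    ultimately show "\<phi> k = cinner k z"
      by (rule LIMSEQ_unique)
  qed
qed

text \<open>Nondegeneracy of the inner product makes the adjoint unique, which is what the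
  \<open>THE\<close> in \<open>adj\<close> demands.\<close>

lemma adj_eqI:
  assumes "\<And>x y. cinner (blinfun_apply A x) y = cinner x (blinfun_apply A' y)"
  shows "adj A = A'"
  unfolding adj_def
proof (rule the_equality)
  show "A'' = A'" if "\<forall>x y. cinner (blinfun_apply A x) y = cinner x (blinfun_apply A'' y)" for A''
    by (rule blinfun_eqI, rule cinner_ext) (simp add: that[rule_format, symmetric] assms)
qed (use assms in auto)

text \<open>Existence comes from Riesz applied, for each fixed \<open>y\<close>, to the functional
  pairing \<open>A x\<close> with \<open>y\<close>.\<close>

lemma
  fixes A :: "'a::chilbert_space \<Rightarrow>\<^sub>L 'b::chilbert_space"
  assumes A: "A \<in> cblin"
  shows cinner_adj: "cinner (blinfun_apply A x) y = cinner x (blinfun_apply (adj A) y)"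
    and adj_cblin: "adj A \<in> cblin"
proof -
  have "\<exists>z. \<forall>x. cinner (A x) y = cinner x z" for y
  proof -
    have "clinear_on UNIV (\<lambda>x. cinner (A x) y)"
      by (simp add: clinear_on_def cinner_add_left cinner_scaleC_left blinfun.add_right cblinD[OF A]
          scaleC_complex_def)
    moreover have "cmod (cinner (A x) y) \<le> (norm A * norm y) * norm x" for x
      using order_trans[OF cmod_cinner_le mult_right_mono[OF norm_blinfun norm_ge_zero], of A x y]
      by (simp add: mult_ac)
    ultimately show ?thesis
      by (rule Riesz_representation) blast
  qed
  then obtain f where f: "\<And>x y. cinner (A x) y = cinner x (f y)"
    by metis
  have "clinear_on UNIV f"
    unfolding clinear_on_def
    by (intro conjI ballI allI; rule cinner_ext)
      (simp_all add: f[symmetric] cinner_add_right cinner_scaleC_right)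
  moreover have "norm (f y) \<le> norm A * norm y" for y
  proof (cases "f y = 0")
    case False
    \<comment> \<open>The defining identity at \<open>x = f y\<close>; cancelling one factor
      \<open>norm (f y)\<close> gives boundedness.\<close>
    have "norm (f y) * norm (f y) = cmod (cinner (A (f y)) y)"
      by (simp add: f cinner_self power2_eq_square norm_mult)
    also have "\<dots> \<le> norm A * norm (f y) * norm y"
      by (intro order_trans[OF cmod_cinner_le] mult_right_mono norm_blinfun) simp
    finally show ?thesis
      using False by (simp add: mult.commute mult.left_commute)
  qed simp
  ultimately have "\<exists>A'\<in>cblin. \<forall>y. blinfun_apply A' y = f y"
    using cblin_of_clinear[of f "norm A"] by metis
  then obtain A' where A': "A' \<in> cblin" "\<And>y. blinfun_apply A' y = f y"
    by blast
  have "adj A = A'"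
    by (rule adj_eqI) (simp add: f A')
  then show "cinner (A x) y = cinner x (adj A y)" "adj A \<in> cblin"
    using f A' by auto
qed

lemma cinner_adj_left:
  "A \<in> cblin \<Longrightarrow> cinner (blinfun_apply (adj A) y) x = cinner y (blinfun_apply A x)"
  by (subst (1 2) cinner_commute) (simp add: cinner_adj)

lemma adj_adj: "A \<in> cblin \<Longrightarrow> adj (adj A) = A"
  by (rule adj_eqI) (rule cinner_adj_left)


section \<open>Coordinates of vectors of words\<close>

lemma has_sum_cinner_ell2:
  "((\<lambda>i. cinner (ell2_nth f i) (ell2_nth g i)) has_sum cinner f g) UNIV"
  by transfer (intro has_sum_infsum ell2_cinner_summable)

lemma has_sum_norm_ell2: "((\<lambda>i. (norm (ell2_nth f i))\<^sup>2) has_sum (norm f)\<^sup>2) UNIV"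
  by transfer (simp add: infsum_nonneg)

lemma cinner_ell2_finite: "cinner f g = (\<Sum>i\<in>UNIV. cinner (ell2_nth f (i::'i::finite)) (ell2_nth g i))"
  using has_sum_cinner_ell2[of f g] by (simp add: has_sum_finite_iff)

lift_definition restrict_ell2 :: "'i set \<Rightarrow> ('i, 'a::complex_inner) ell2 \<Rightarrow> ('i, 'a) ell2"
  is "\<lambda>S f i. if i \<in> S then f i else 0"
  subgoal for S f by (rule summable_on_comparison_test[of "\<lambda>i. (norm (f i))\<^sup>2"]) auto
  done

lemma ell2_nth_restrict [simp]: "ell2_nth (restrict_ell2 S f) i = (if i \<in> S then ell2_nth f i else 0)"
  by transfer simp

lemma ell2_nth_level_part [simp]:
  "ell2_nth (level_part k f) \<sigma> = (if length \<sigma> = k then ell2_nth f \<sigma> else 0)"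
  by transfer simp

lemma ell2_nth_summand [simp]: "ell2_nth (summand a f) \<sigma> = ell2_nth f (a # \<sigma>)"
  by transfer simp

lemma ell2_nth_diag [simp]: "ell2_nth (blinfun_apply (diag A) f) i = blinfun_apply A (ell2_nth f i)"
  by (simp add: diag.rep_eq Abs_ell2_inverse ell2_pointwise)

lemma ell2_nth_sum: "ell2_nth (\<Sum>i\<in>A. f i) j = (\<Sum>i\<in>A. ell2_nth (f i) j)"
  by (induction A rule: infinite_finite_induct) auto

lemma cinner_restrict_finite:
  assumes "finite F"
  shows "cinner f (restrict_ell2 F g) = (\<Sum>i\<in>F. cinner (ell2_nth f i) (ell2_nth g i))"
proof -
  have "((\<lambda>i. cinner (ell2_nth f i) (ell2_nth (restrict_ell2 F g) i)) has_sum
      (\<Sum>i\<in>F. cinner (ell2_nth f i) (ell2_nth g i))) UNIV"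
    by (rule has_sum_finite_neutralI[OF assms]) auto
  then show ?thesis
    using has_sum_cinner_ell2 has_sum_unique by blast
qed

text \<open>By Pythagoras the squared error equals the squared norm minus its partial sum over
  \<open>F\<close>.\<close>

lemma restrict_ell2_tendsto: "((\<lambda>F. restrict_ell2 F f) \<longlongrightarrow> f) (finite_subsets_at_top UNIV)"
proof -
  let ?n = "\<lambda>i. (norm (ell2_nth f i))\<^sup>2"
  have eq: "(norm (restrict_ell2 F f - f))\<^sup>2 = (norm f)\<^sup>2 - sum ?n F" if "finite F" for F
  proof -
    have "((\<lambda>i. if i \<in> F then ?n i else 0) has_sum sum ?n F) UNIV"
      by (rule has_sum_finite_neutralI[OF that]) auto
    from has_sum_add[OF has_sum_norm_ell2[of "restrict_ell2 F f - f"] this]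
    have "(?n has_sum (norm (restrict_ell2 F f - f))\<^sup>2 + sum ?n F) UNIV"
      by (rule has_sum_cong[THEN iffD1, rotated]) auto
    from has_sum_unique[OF this has_sum_norm_ell2[of f]] show ?thesis
      by simp
  qed
  have "((\<lambda>F. (norm f)\<^sup>2 - sum ?n F) \<longlongrightarrow> (norm f)\<^sup>2 - (norm f)\<^sup>2) (finite_subsets_at_top UNIV)"
    by (intro tendsto_intros) (use has_sum_norm_ell2[of f] in \<open>simp add: has_sum_def\<close>)
  then have "((\<lambda>F. sqrt ((norm (restrict_ell2 F f - f))\<^sup>2)) \<longlongrightarrow> sqrt 0) (finite_subsets_at_top UNIV)"
    by (intro tendsto_real_sqrt, subst tendsto_cong) (auto intro!: eventually_finite_subsets_at_top_weakI eq)
  then show ?thesis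
    by (simp add: tendsto_norm_zero_iff LIM_zero_iff)
qed

lemma finite_words_less: "finite {\<sigma> :: 'n::finite list. length \<sigma> < k}"
  by (rule finite_subset[OF _ finite_lists_length_le[of UNIV k]]) auto

text \<open>As the alphabet is finite, bounded length leaves finitely many words, and these sets
  eventually contain every finite set of words.\<close>

lemma truncate_tendsto:
  fixes f :: "('n::finite list, 'a::complex_inner) ell2"
  shows "(\<lambda>k. restrict_ell2 {\<sigma>. length \<sigma> < k} f) \<longlonglongrightarrow> f"
proof (rule filterlim_compose[OF restrict_ell2_tendsto])
  have "\<forall>\<^sub>F k in sequentially. X \<subseteq> {\<sigma>. length \<sigma> < k}" if "finite X" for X :: "'n list set"
  proof (rule eventually_sequentiallyI)
    fix k
    assume "Suc (\<Sum>\<sigma>\<in>X. length \<sigma>) \<le> k"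
    then show "X \<subseteq> {\<sigma>. length \<sigma> < k}"
      using member_le_sum[of _ X length] that by fastforce
  qed
  then show "filterlim (\<lambda>k. {\<sigma> :: 'n list. length \<sigma> < k}) (finite_subsets_at_top UNIV) sequentially"
    unfolding filterlim_finite_subsets_at_top by (auto simp: finite_words_less elim: eventually_mono)
qed

lemma truncate_eq_sum_levels:
  "restrict_ell2 {\<sigma>. length \<sigma> < k} f = (\<Sum>j<k. level_part j f)"
  by (rule ell2_eqI) (simp add: ell2_nth_sum sum.delta)

section \<open>Backward shifts and the upper triangular algebra\<close>

text \<open>A nonempty word has a unique first letter. Thus a vector is the orthogonal sum of its
  coordinate at \<open>[]\<close> and its shifts; the lifting step rests on this splitting.\<close>

lemma norm_split_first_letter:
  fixes f :: "('n::finite list, 'a::complex_inner) ell2"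
  shows "(norm f)\<^sup>2 = (norm (ell2_nth f []))\<^sup>2 + (\<Sum>a\<in>UNIV. (norm (summand a f))\<^sup>2)"
proof -
  let ?n = "\<lambda>\<sigma>. (norm (ell2_nth f \<sigma>))\<^sup>2"
  have "(?n has_sum (norm (summand a f))\<^sup>2) (range ((#) a))" for a
    using has_sum_norm_ell2[of "summand a f"] by (subst has_sum_reindex) (auto simp: o_def)
  then have "(?n has_sum (\<Sum>a\<in>UNIV. (norm (summand a f))\<^sup>2)) (\<Union>a. range ((#) a))"
    by (intro sum_has_sum) auto
  then have "(?n has_sum (?n [] + (\<Sum>a\<in>UNIV. (norm (summand a f))\<^sup>2))) (insert [] (\<Union>a. range ((#) a)))"
    by (subst has_sum_insert) auto
  moreover have "insert [] (\<Union>a. range ((#) a)) = (UNIV :: 'n list set)"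
    by (auto simp: image_iff) (metis list.exhaust)
  ultimately show ?thesis
    using has_sum_norm_ell2[of f] has_sum_unique by metis
qed

lemma summand_simps [simp]:
  "summand a (f + g) = summand a f + summand a g"
  "summand a (f - g) = summand a f - summand a g"
  "summand a (c *\<^sub>C f) = c *\<^sub>C summand a f"
  "summand a 0 = 0"
  by (rule ell2_eqI; simp)+

lemma summand_sum: "summand a (\<Sum>i\<in>A. f i) = (\<Sum>i\<in>A. summand a (f i))"
  by (induction A rule: infinite_finite_induct) auto

lemma norm_summand_le: "norm (summand a f) \<le> norm (f :: ('n::finite list, 'a::complex_inner) ell2)"
proof -
  have "(norm (summand a f))\<^sup>2 \<le> (\<Sum>a\<in>UNIV. (norm (summand a f))\<^sup>2)"
    by (rule member_le_sum) auto
  then have "(norm (summand a f))\<^sup>2 \<le> (norm f)\<^sup>2"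
    unfolding norm_split_first_letter[of f] by (simp add: add_increasing)
  then show ?thesis
    by simp
qed

lemma summand_tendsto:
  fixes s :: "nat \<Rightarrow> ('n::finite list, 'a::complex_inner) ell2"
  assumes "s \<longlonglongrightarrow> f"
  shows "(\<lambda>k. summand a (s k)) \<longlonglongrightarrow> summand a f"
proof (rule LIM_zero_cancel, rule Lim_null_comparison)
  show "\<forall>\<^sub>F k in sequentially. norm (summand a (s k) - summand a f) \<le> norm (s k - f)"
    by (simp add: summand_simps(2)[symmetric] norm_summand_le del: summand_simps)
qed (use assms in \<open>simp add: LIM_zero tendsto_norm_zero\<close>)

lemma summand_level_part:
  "summand a (level_part j f) = (if j = 0 then 0 else level_part (j - 1) (summand a f))"
  by (rule ell2_eqI) auto

lemma level_part_zero [simp]: "level_part k 0 = 0"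
  by (rule ell2_eqI) simp

text \<open>The block conditions are the commutation relation read one level at a time. Conversely,
  commutation lets letters be peeled off the output word, which yields both the repeated blocks and
  the vanishing below the diagonal.\<close>

lemma upper_tri_iff:
  fixes T :: "('n::finite list, 'e::complex_inner) ell2 \<Rightarrow>\<^sub>L ('n list, 'e) ell2"
  shows "T \<in> upper_tri \<longleftrightarrow> T \<in> cblin \<and> (\<forall>a f. summand a (T f) = T (summand a f))"
proof (intro iffI conjI allI)
  assume T: "T \<in> upper_tri"
  then show "T \<in> cblin"
    by (simp add: upper_tri_def)
  have low: "block T i j = (\<lambda>_. 0)" if "j < i" for i j
    using T that by (simp add: upper_tri_def)
  have up: "block T i j = copies (block T (i - 1) (j - 1))" if "1 \<le> i" "i \<le> j" for i j
    using T that by (simp add: upper_tri_def)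
  have level: "summand a (T (level_part j f)) = T (summand a (level_part j f))" for a j f
  proof (rule ell2_eqI)
    fix \<sigma>
    have "ell2_nth (summand a (T (level_part j f))) \<sigma>
        = ell2_nth (block T (Suc (length \<sigma>)) j f) (a # \<sigma>)"
      by (simp add: block_def)
    also have "\<dots> = ell2_nth (T (summand a (level_part j f))) \<sigma>"
    proof (cases "Suc (length \<sigma>) \<le> j")
      case True
      then show ?thesis
        by (simp add: up ell2_nth_copies) (simp add: block_def summand_level_part)
    next
      \<comment> \<open>Both entries lie strictly below the diagonal. The value \<open>j = 0\<close>
        is separate because there \<open>j - 1\<close> is again \<open>0\<close>; the shift kills
        the vector instead.\<close>
      case False
      show ?thesis
      proof (cases "j = 0")
        case False
        with \<open>\<not> Suc (length \<sigma>) \<le> j\<close>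
        have "ell2_nth (block T (length \<sigma>) (j - 1) (summand a f)) \<sigma> = 0"
          by (simp add: low)
        then have "ell2_nth (T (summand a (level_part j f))) \<sigma> = 0"
          using False by (simp add: block_def summand_level_part)
        then show ?thesis
          using \<open>\<not> Suc (length \<sigma>) \<le> j\<close> by (simp add: low)
      qed (simp add: low summand_level_part blinfun.zero_right)
    qed
    finally show "ell2_nth (summand a (T (level_part j f))) \<sigma> = ell2_nth (T (summand a (level_part j f))) \<sigma>" .
  qed
  \<comment> \<open>Linearity carries the identity from single levels to truncations, and continuity
    carries it to \<open>f\<close>.\<close>
  show "summand a (T f) = T (summand a f)" for a f
  proof (rule LIMSEQ_unique)
    have T_lim: "(\<lambda>k. T (s k)) \<longlonglongrightarrow> T g" if "s \<longlonglongrightarrow> g" for s g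
      using blinfun.tendsto[OF tendsto_const that] .
    let ?t = "\<lambda>k. restrict_ell2 {\<sigma>. length \<sigma> < k} f"
    show "(\<lambda>k. summand a (T (?t k))) \<longlonglongrightarrow> summand a (T f)"
      by (intro summand_tendsto T_lim truncate_tendsto)
    have "summand a (T (?t k)) = T (summand a (?t k))" for k
      by (simp add: truncate_eq_sum_levels blinfun.sum_right summand_sum level)
    then show "(\<lambda>k. summand a (T (?t k))) \<longlonglongrightarrow> T (summand a f)"
      using T_lim[OF summand_tendsto[OF truncate_tendsto]] by simp
  qed
next
  assume T: "T \<in> cblin \<and> (\<forall>a f. summand a (T f) = T (summand a f))"
  then have comm: "ell2_nth (T f) (a # \<sigma>) = ell2_nth (T (summand a f)) \<sigma>" for a f \<sigma>
    by (metis ell2_nth_summand)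
  \<comment> \<open>Each letter peeled off lowers \<open>j\<close> by one; since the word is longer
    than \<open>j\<close>, level \<open>0\<close> is reached with a letter to spare, and that shift
    gives zero.\<close>
  have low: "ell2_nth (T (level_part j f)) \<sigma> = 0" if "j < length \<sigma>" for j f \<sigma>
    using that by (induction \<sigma> arbitrary: j f) (auto simp: comm summand_level_part blinfun.zero_right)
  show "T \<in> upper_tri"
    unfolding upper_tri_def
  proof (intro CollectI conjI allI impI)
    show "T \<in> cblin"
      using T by blast
    show "block T i j = (\<lambda>_. 0)" if "j < i" for i j
      by (intro ext ell2_eqI) (use that low in \<open>auto simp: block_def\<close>)
    show "block T i j = copies (block T (i - 1) (j - 1))" if "1 \<le> i \<and> i \<le> j" for i j
    proof (intro ext ell2_eqI)
      fix f \<sigma>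
      show "ell2_nth (block T i j f) \<sigma> = ell2_nth (copies (block T (i - 1) (j - 1)) f) \<sigma>"
        using that by (cases \<sigma>) (auto simp: block_def ell2_nth_copies comm summand_level_part)
    qed
  qed
qed


section \<open>The column operator and the Pick matrix\<close>

lemma scaleC_zero_right [simp]: "c *\<^sub>C 0 = (0::'a::complex_inner)"
  using scaleC_add_right[of c 0 0] by simp

lemma scaleC_diff_right: "c *\<^sub>C (x - y) = c *\<^sub>C x - c *\<^sub>C (y::'a::complex_inner)"
  using scaleC_add_right[of c "x - y" y] by simp

lemma scaleC_sum_right: "c *\<^sub>C (\<Sum>i\<in>A. f i) = (\<Sum>i\<in>A. c *\<^sub>C f i :: 'a::complex_inner)"
  by (induction A rule: infinite_finite_induct) (auto simp: scaleC_add_right)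

lemma cinner_diff_left: "cinner (x - y) z = cinner x z - cinner y (z::'a::complex_inner)"
  using cinner_add_left[of "x - y" y z] by simp

section \<open>Strict row contractions and the column operator\<close>

lemma op_ball_cblin: "Z \<in> op_ball \<Longrightarrow> Z a \<in> cblin"
  by (auto simp: op_ball_def)

lemma cinner_row_gram:
  assumes "\<And>a. Z a \<in> cblin"
  shows "cinner (row_gram Z x) y = (\<Sum>a\<in>UNIV. cinner (Z a x) (Z a y))"
  by (simp add: row_gram_def blinfun.sum_left cinner_sum_left cinner_adj_left[OF assms])

text \<open>Bounded invertibility makes the positive operator \<open>G = I - (Z|Z)\<close> bounded
  below, with the norm of its inverse as constant. This uniform gap is what makes the column square
  summable.\<close>

lemma op_ball_strict:
  fixes Z :: "'n::finite \<Rightarrow> 'e::chilbert_space \<Rightarrow>\<^sub>L 'e"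
  assumes "Z \<in> op_ball"
  obtains K where "0 \<le> K" "\<And>x. (norm x)\<^sup>2 \<le> K * ((norm x)\<^sup>2 - (\<Sum>a\<in>UNIV. (norm (Z a x))\<^sup>2))"
proof -
  note Z = op_ball_cblin[OF assms]
  define G where "G = id_blinfun - row_gram Z"
  have G: "cinner (G x) y = cinner x y - (\<Sum>a\<in>UNIV. cinner (Z a x) (Z a y))" for x y
    by (simp add: G_def blinfun.diff_left cinner_diff_left cinner_row_gram[OF Z])
  have Gpos: "0 \<le> Re (cinner (G x) x)" for x
    using assms by (simp add: op_ball_def positive_op_def G_def)
  interpret G: semi_inner "\<lambda>x y. cinner (G x) y"
  proof
    show "cinner (G x) y = cnj (cinner (G y) x)" for x y
      by (simp add: G cinner_commute[symmetric])
    show "0 \<le> Re (cinner (G x) x)" for x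
      by (rule Gpos)
  qed (simp_all add: G cinner_add_left cinner_scaleC_left blinfun.add_right
      cblinD[OF Z] sum.distrib right_diff_distrib sum_distrib_left)
  have "\<exists>G'. G o\<^sub>L G' = id_blinfun"
    using assms by (auto simp: op_ball_def boundedly_invertible_def G_def)
  then obtain G' where "G o\<^sub>L G' = id_blinfun"
    by blast
  then have G': "G (G' x) = x" for x
    by (metis blinfun_apply_blinfun_compose id_blinfun.rep_eq)
  have q: "Re (cinner (G x) x) = (norm x)\<^sup>2 - (\<Sum>a\<in>UNIV. (norm (Z a x))\<^sup>2)" for x
    by (simp add: G cinner_self)
  show ?thesis
  proof (rule that[of "norm G'"])
    fix x
    define p where "p = Re (cinner (G x) x)"
    have "(norm x)\<^sup>2 \<le> norm G' * p"
    proof (cases "x = 0")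
      case True
      then show ?thesis
        by (simp add: p_def)
    next
      case False
      have 1: "Re (cinner x (G' x)) \<le> norm G' * (norm x)\<^sup>2"
      proof -
        have "Re (cinner x (G' x)) \<le> norm x * norm (G' x)"
          by (rule order_trans[OF complex_Re_le_cmod cmod_cinner_le])
        also have "\<dots> \<le> norm x * (norm G' * norm x)"
          by (intro mult_left_mono norm_blinfun) simp
        finally show ?thesis
          by (simp add: power2_eq_square mult_ac)
      qed
      \<comment> \<open>Cauchy-Schwarz for the form of \<open>G\<close> at \<open>G' x\<close> and
        \<open>x\<close>; since \<open>G (G' x) = x\<close>, it compares the ordinary norm with the
        form.\<close>
      have "cmod (cinner x x) \<le> sqrt (Re (cinner x (G' x))) * sqrt p"
        using G.Q_Cauchy_Schwarz[of "G' x" x] by (simp only: G' p_def)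
      also have "cmod (cinner x x) = (norm x)\<^sup>2"
        by (simp add: cinner_self norm_power)
      finally have "((norm x)\<^sup>2)\<^sup>2 \<le> (sqrt (Re (cinner x (G' x))) * sqrt p)\<^sup>2"
        by (rule power_mono) simp
      also have "\<dots> = Re (cinner x (G' x)) * p"
        using Gpos[of "G' x"] Gpos[of x] by (simp add: power_mult_distrib G' p_def)
      also have "\<dots> \<le> norm G' * (norm x)\<^sup>2 * p"
        using Gpos[of x] by (intro mult_right_mono 1) (simp add: p_def)
      finally have "(norm x)\<^sup>2 * (norm x)\<^sup>2 \<le> (norm G' * p) * (norm x)\<^sup>2"
        by (simp add: power2_eq_square mult_ac)
      then show ?thesis
        by (rule mult_right_le_imp_le) (use False in simp)
    qed
    then show "(norm x)\<^sup>2 \<le> norm G' * ((norm x)\<^sup>2 - (\<Sum>a\<in>UNIV. (norm (Z a x))\<^sup>2))"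
      by (simp only: p_def q)
  qed simp
qed

text \<open>The adjoint of \<open>word_adj\<close>, so the first letter acts first; these are the
  entries of the column \<open>L(Z)^*\<close>.\<close>

primrec word_op :: "('n \<Rightarrow> 'e::complex_inner \<Rightarrow>\<^sub>L 'e) \<Rightarrow> 'n list \<Rightarrow> 'e \<Rightarrow>\<^sub>L 'e" where
  "word_op Z [] = id_blinfun"
| "word_op Z (a # \<sigma>) = word_op Z \<sigma> o\<^sub>L Z a"

lemma cinner_word_op:
  assumes "\<And>a. Z a \<in> cblin"
  shows "cinner (word_op Z \<sigma> x) y = cinner x (word_adj Z \<sigma> y)"
  by (induction \<sigma> arbitrary: x) (simp_all add: cinner_adj[OF assms])

lemma word_op_cblin: "(\<And>a. Z a \<in> cblin) \<Longrightarrow> word_op Z \<sigma> \<in> cblin"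
  by (induction \<sigma>) (auto simp: cblin_def)

lemma sum_words_Suc:
  fixes g :: "'n::finite list \<Rightarrow> real"
  shows "(\<Sum>\<sigma> | length \<sigma> < Suc k. g \<sigma>) = g [] + (\<Sum>a\<in>UNIV. \<Sum>\<sigma> | length \<sigma> < k. g (a # \<sigma>))"
proof -
  have "{\<sigma> :: 'n list. length \<sigma> < Suc k} = insert [] (\<Union>a. (#) a ` {\<sigma>. length \<sigma> < k})"
  proof (intro set_eqI)
    show "\<sigma> \<in> {\<sigma>. length \<sigma> < Suc k} \<longleftrightarrow> \<sigma> \<in> insert [] (\<Union>a. (#) a ` {\<sigma>. length \<sigma> < k})"
      for \<sigma> :: "'n list"
      by (cases \<sigma>) auto
  qed
  moreover have "sum g (\<Union>a. (#) a ` {\<sigma>. length \<sigma> < k}) = (\<Sum>a\<in>UNIV. \<Sum>\<sigma> | length \<sigma> < k. g (a # \<sigma>))"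
    by (subst sum.UNION_disjoint) (auto simp: finite_words_less sum.reindex)
  ultimately show ?thesis
    by (simp add: finite_words_less image_iff)
qed

text \<open>Splitting off the first letter reduces the sum for \<open>x\<close> to those for
  \<open>Z a x\<close>. The inequality on \<open>K\<close> is exactly what lets the bound reproduce
  itself in the induction.\<close>

lemma word_op_square_sum:
  fixes Z :: "'n::finite \<Rightarrow> 'e::complex_inner \<Rightarrow>\<^sub>L 'e"
  assumes "0 \<le> K" and K: "\<And>x. (norm x)\<^sup>2 \<le> K * ((norm x)\<^sup>2 - (\<Sum>a\<in>UNIV. (norm (Z a x))\<^sup>2))"
  shows "(\<Sum>\<sigma> | length \<sigma> < k. (norm (word_op Z \<sigma> x))\<^sup>2) \<le> K * (norm x)\<^sup>2"
proof (induction k arbitrary: x)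
  case (Suc k)
  have "(\<Sum>\<sigma> | length \<sigma> < Suc k. (norm (word_op Z \<sigma> x))\<^sup>2)
      \<le> (norm x)\<^sup>2 + (\<Sum>a\<in>UNIV. K * (norm (Z a x))\<^sup>2)"
    by (simp add: sum_words_Suc Suc sum_mono)
  also have "\<dots> \<le> K * (norm x)\<^sup>2"
    using K[of x] by (simp add: sum_distrib_left[symmetric] right_diff_distrib)
  finally show ?case .
qed (simp add: assms)

text \<open>The column is built before the row: its boundedness is a matter of square sums, and the
  row is then recovered as its adjoint.\<close>

lemma column_op:
  fixes Z :: "'n::finite \<Rightarrow> 'e::chilbert_space \<Rightarrow>\<^sub>L 'e"
  assumes "Z \<in> op_ball"
  obtains C where "C \<in> cblin" "\<And>x \<sigma>. ell2_nth (blinfun_apply C x) \<sigma> = word_op Z \<sigma> x"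
proof -
  note Z = op_ball_cblin[OF assms]
  obtain K where K: "0 \<le> K" "\<And>x. (norm x)\<^sup>2 \<le> K * ((norm x)\<^sup>2 - (\<Sum>a\<in>UNIV. (norm (Z a x))\<^sup>2))"
    using op_ball_strict[OF assms] by metis
  have L2: "L2_set (\<lambda>\<sigma>. norm (word_op Z \<sigma> x)) F \<le> sqrt K * norm x" if "finite F" for F x
  proof -
    \<comment> \<open>The total length of the words in \<open>F\<close> bounds each single
      length.\<close>
    have "F \<subseteq> {\<sigma>. length \<sigma> < Suc (\<Sum>\<sigma>\<in>F. length \<sigma>)}"
      using member_le_sum[of _ F length] that by fastforce
    then have "(\<Sum>\<sigma>\<in>F. (norm (word_op Z \<sigma> x))\<^sup>2) \<le> K * (norm x)\<^sup>2"
      by (intro order_trans[OF sum_mono2 word_op_square_sum[OF K]]) (auto simp: finite_words_less)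
    then show ?thesis
      using real_sqrt_le_mono by (fastforce simp: L2_set_def real_sqrt_mult)
  qed
  define c where "c x = Abs_ell2 (\<lambda>\<sigma>. word_op Z \<sigma> x)" for x
  have nth: "ell2_nth (c x) \<sigma> = word_op Z \<sigma> x" for x \<sigma>
    unfolding c_def using L2_bounded_imp_ell2(1)[OF L2] by (simp add: Abs_ell2_inverse)
  have "clinear_on UNIV c"
    unfolding clinear_on_def
    by (intro conjI ballI allI; rule ell2_eqI)
      (simp_all add: nth blinfun.add_right cblinD[OF word_op_cblin[OF Z]])
  moreover have "norm (c x) \<le> sqrt K * norm x" for x
    by (rule norm_ell2_le) (simp add: nth L2)
  ultimately have "\<exists>C\<in>cblin. \<forall>x. blinfun_apply C x = c x"
    using cblin_of_clinear[of c "sqrt K"] by metis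
  then show ?thesis
    using that nth by metis
qed

text \<open>Finite partial sums of the row are \<open>adj C\<close> applied to truncations, so by
  continuity the series sums to \<open>adj C\<close>. Hence the function under
  \<open>Blinfun\<close> is a bounded operator.\<close>

lemma
  fixes Z :: "'n::finite \<Rightarrow> 'e::chilbert_space \<Rightarrow>\<^sub>L 'e"
  assumes "Z \<in> op_ball"
  shows row_op_cblin: "row_op Z \<in> cblin"
    and ell2_nth_adj_row_op: "ell2_nth (adj (row_op Z) x) \<sigma> = word_op Z \<sigma> x"
proof -
  note Z = op_ball_cblin[OF assms]
  obtain C where C: "C \<in> cblin" "\<And>x \<sigma>. ell2_nth (blinfun_apply C x) \<sigma> = word_op Z \<sigma> x"
    using column_op[OF assms] by metis
  have sum: "(\<Sum>\<sigma>\<in>F. word_adj Z \<sigma> (ell2_nth f \<sigma>)) = adj C (restrict_ell2 F f)" if "finite F" for F f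
  proof (rule cinner_ext)
    show "cinner x (\<Sum>\<sigma>\<in>F. word_adj Z \<sigma> (ell2_nth f \<sigma>)) = cinner x (adj C (restrict_ell2 F f))" for x
      by (simp add: cinner_sum_right cinner_adj[OF C(1), symmetric] cinner_restrict_finite[OF that]
          C(2) cinner_word_op[OF Z])
  qed
  have "((\<lambda>\<sigma>. word_adj Z \<sigma> (ell2_nth f \<sigma>)) has_sum adj C f) UNIV" for f
  proof -
    have "((\<lambda>F. adj C (restrict_ell2 F f)) \<longlongrightarrow> adj C f) (finite_subsets_at_top UNIV)"
      by (intro blinfun.tendsto tendsto_const restrict_ell2_tendsto)
    then show ?thesis
      unfolding has_sum_def
      by (rule Lim_transform_eventually)
        (auto intro!: eventually_finite_subsets_at_top_weakI simp: sum)
  qed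
  then have "row_op Z = Blinfun (blinfun_apply (adj C))"
    unfolding row_op_def by (intro arg_cong[of _ _ Blinfun] ext infsumI)
  then have row: "row_op Z = adj C"
    by (simp add: blinfun_apply_inverse)
  show "row_op Z \<in> cblin"
    by (simp add: row adj_cblin C)
  show "ell2_nth (adj (row_op Z) x) \<sigma> = word_op Z \<sigma> x"
    by (simp add: row adj_adj C)
qed

lemma summand_adj_row_op:
  "Z \<in> op_ball \<Longrightarrow> summand a (adj (row_op Z) x) = adj (row_op Z) (Z a x)"
  by (rule ell2_eqI) (simp add: ell2_nth_adj_row_op)

section \<open>Diagonal operators and the quadratic form of the Pick matrix\<close>

lemma summand_diag: "summand a (diag A f) = diag A (summand a f)"
  by (rule ell2_eqI) simp

lemma diag_cblin: "A \<in> cblin \<Longrightarrow> diag A \<in> cblin"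
  by (auto simp: cblin_def intro: ell2_eqI)

lemma cinner_diag_adj:
  assumes "A \<in> cblin"
  shows "cinner (diag (adj A) f) g = cinner f (diag A g)"
  using has_sum_cinner_ell2[of "diag (adj A) f" g] has_sum_cinner_ell2[of f "diag A g"]
  by (simp add: cinner_adj_left[OF assms] has_sum_unique)

lemma diag_defect: "diag (id_blinfun - (adj A o\<^sub>L B)) f = f - diag (adj A) (diag B f)"
  by (rule ell2_eqI) (simp add: blinfun.diff_left)

lemma ell2_nth_op_matrix: "ell2_nth (op_matrix A f) i = (\<Sum>j\<in>UNIV. A i j (ell2_nth f j))"
  by (simp add: op_matrix.rep_eq ell2_nth_Abs_finite)

text \<open>Since \<open>diag\<close> respects products and adjoints, the quadratic form of the Pick
  matrix at \<open>x\<close> is the squared norm of \<open>S x\<close> minus that of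
  \<open>D x\<close>.\<close>

lemma positive_pick_matrix_iff:
  fixes Z :: "'m::finite \<Rightarrow> 'n::finite \<Rightarrow> 'e::chilbert_space \<Rightarrow>\<^sub>L 'e"
  assumes Z: "\<And>k. Z k \<in> op_ball" and B: "\<And>k. B k \<in> cblin"
  defines "S \<equiv> \<lambda>x::('m, 'e) ell2. \<Sum>k\<in>UNIV. adj (row_op (Z k)) (ell2_nth x k)"
    and "D \<equiv> \<lambda>x::('m, 'e) ell2. \<Sum>k\<in>UNIV. diag (B k) (adj (row_op (Z k)) (ell2_nth x k))"
  shows "positive_op (pick_matrix Z B) \<longleftrightarrow> (\<forall>x. norm (D x) \<le> norm (S x))"
proof -
  note R = row_op_cblin[OF Z] adj_cblin[OF row_op_cblin[OF Z]]
  have "cinner (pick_matrix Z B x) x = cinner (S x) (S x) - cinner (D x) (D x)" for x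
  proof -
    let ?c = "\<lambda>k. adj (row_op (Z k)) (ell2_nth x k)"
    have "cinner (pick_matrix Z B x) x = (\<Sum>j\<in>UNIV. \<Sum>k\<in>UNIV.
        cinner (row_op (Z j) (?c k - diag (adj (B j)) (diag (B k) (?c k)))) (ell2_nth x j))"
      by (simp add: pick_matrix_def cinner_ell2_finite ell2_nth_op_matrix diag_defect cinner_sum_left)
    also have "\<dots> = (\<Sum>j\<in>UNIV. \<Sum>k\<in>UNIV.
        cinner (?c k) (?c j) - cinner (diag (B k) (?c k)) (diag (B j) (?c j)))"
      by (simp add: cinner_adj[OF R(1)] cinner_diff_left cinner_diag_adj[OF B])
    also have "\<dots> = cinner (S x) (S x) - cinner (D x) (D x)"
      by (simp add: S_def D_def cinner_sum_left cinner_sum_right sum_subtractf)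
    finally show ?thesis .
  qed
  then have form: "cinner (pick_matrix Z B x) x = complex_of_real ((norm (S x))\<^sup>2 - (norm (D x))\<^sup>2)" for x
    by (simp add: cinner_self)
  have defect: "id_blinfun - (adj (B j) o\<^sub>L B k) \<in> cblin" for j k
    using cblinD[OF B] cblinD[OF adj_cblin[OF B]]
    by (simp add: cblin_def blinfun.diff_left scaleC_diff_right)
  have "pick_matrix Z B \<in> cblin"
    unfolding cblin_def
    by (auto intro!: ell2_eqI simp: pick_matrix_def ell2_nth_op_matrix scaleC_sum_right
        cblinD[OF R(1)] cblinD[OF R(2)] cblinD[OF diag_cblin[OF defect]])
  then show ?thesis
    unfolding positive_op_def form by (simp add: abs_le_square_iff[symmetric] del: of_real_diff of_real_power)
qed

text \<open>At the empty word this is the definition of point evaluation; each further letter only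
  replaces \<open>x\<close> by \<open>Z a x\<close>.\<close>

lemma upper_tri_adj_row_op:
  fixes Z :: "'n::finite \<Rightarrow> 'e::chilbert_space \<Rightarrow>\<^sub>L 'e"
  assumes T: "T \<in> upper_tri" and Z: "Z \<in> op_ball"
  shows "T (adj (row_op Z) x) = diag (point_eval T Z) (adj (row_op Z) x)"
proof (rule ell2_eqI)
  fix \<sigma>
  have T': "summand a (T f) = T (summand a f)" for a f
    using T by (simp add: upper_tri_iff)
  show "ell2_nth (T (adj (row_op Z) x)) \<sigma> = ell2_nth (diag (point_eval T Z) (adj (row_op Z) x)) \<sigma>"
  proof (induction \<sigma> arbitrary: x)
    case Nil
    show ?case
      by (simp add: point_eval_def coord.rep_eq ell2_nth_adj_row_op[OF Z])
  next
    case (Cons a \<sigma>)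
    have "ell2_nth (T (adj (row_op Z) x)) (a # \<sigma>) = ell2_nth (T (adj (row_op Z) (Z a x))) \<sigma>"
      by (simp only: ell2_nth_summand[symmetric] T' summand_adj_row_op[OF Z])
    then show ?case
      by (simp add: Cons ell2_nth_adj_row_op[OF Z])
  qed
qed


section \<open>Lifting\<close>

lemma cblin_contraction_extension:
  fixes M :: "'a::complex_inner set" and R :: "'a \<Rightarrow> 'b::chilbert_space"
  assumes "csubspace M" "clinear_on M R" and bound: "\<And>f. f \<in> M \<Longrightarrow> norm (R f) \<le> norm f"
  obtains T where "T \<in> cblin" "\<And>f. norm (blinfun_apply T f) \<le> norm f"
    "\<And>f. f \<in> M \<Longrightarrow> blinfun_apply T f = R f"
proof -
  obtain R' where R': "clinear_on UNIV R'" "\<And>f. f \<in> M \<Longrightarrow> R' f = R f"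
    "\<And>f. (norm (R' f))\<^sup>2 \<le> (norm f)\<^sup>2"
    using cinner.contraction_extension[OF assms(1,2)] bound by (auto simp: q_cinner)
  have "norm (R' f) \<le> norm f" for f
    using R'(3)[of f] by simp
  moreover from this have "\<exists>T\<in>cblin. \<forall>f. blinfun_apply T f = R' f"
    using cblin_of_clinear[OF R'(1), of 1] by (metis mult_1)
  ultimately show ?thesis
    using that R'(2) by metis
qed

text \<open>The operator is total, but it has to commute with the backward shifts only on
  \<open>M\<close>; its values elsewhere are provisional.\<close>

definition coinvariant_contraction ::
    "('n::finite list, 'e::chilbert_space) ell2 set \<Rightarrow> (('n list, 'e) ell2 \<Rightarrow>\<^sub>L ('n list, 'e) ell2) \<Rightarrow> bool" where
  "coinvariant_contraction M T \<longleftrightarrow> csubspace M \<and> T \<in> cblin \<and> (\<forall>f. norm (T f) \<le> norm f) \<and>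
    (\<forall>f\<in>M. \<forall>a. summand a f \<in> M \<and> summand a (T f) = T (summand a f))"

text \<open>This contains \<open>M\<close> when \<open>M\<close> is invariant under the shifts;
  \<open>n\<close> iterations reach all vectors supported on words shorter than
  \<open>n\<close>.\<close>

definition shift_preimage :: "('n list, 'e::complex_inner) ell2 set \<Rightarrow> ('n list, 'e) ell2 set" where
  "shift_preimage M = {f. \<forall>a. summand a f \<in> M}"

text \<open>On the enlarged space all coordinates of the extension except the one at the empty word are
  forced; that one is found by extending it from \<open>M\<close> with respect to the semi-inner product given
  by the defect of the forced part.\<close>

lemma coinvariant_contraction_step:
  fixes M :: "('n::finite list, 'e::chilbert_space) ell2 set"
  assumes "coinvariant_contraction M T"
  obtains T' where "coinvariant_contraction (shift_preimage M) T'" "\<And>f. f \<in> M \<Longrightarrow> T' f = T f"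
proof -
  have M: "csubspace M" and T: "T \<in> cblin" and Tle: "\<And>f. norm (T f) \<le> norm f"
    and inv: "\<And>f a. f \<in> M \<Longrightarrow> summand a f \<in> M"
    and comm: "\<And>f a. f \<in> M \<Longrightarrow> summand a (T f) = T (summand a f)"
    using assms by (auto simp: coinvariant_contraction_def)
  \<comment> \<open>\<open>Q f f\<close> is the part of the squared norm of \<open>f\<close> left
    for the coordinate at \<open>[]\<close> once the shifts of the image are fixed as
    \<open>T (summand a f)\<close>.\<close>
  define Q where "Q f g = cinner f g - (\<Sum>a\<in>UNIV. cinner (T (summand a f)) (T (summand a g)))" for f g
  have q: "Re (Q f f) = (norm f)\<^sup>2 - (\<Sum>a\<in>UNIV. (norm (T (summand a f)))\<^sup>2)" for f
    by (simp add: Q_def cinner_self)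
  interpret Q: semi_inner Q
  proof
    show "Q f g = cnj (Q g f)" for f g
      by (simp add: Q_def cinner_commute[symmetric])
    show "0 \<le> Re (Q f f)" for f
    proof -
      have "(\<Sum>a\<in>UNIV. (norm (T (summand a f)))\<^sup>2) \<le> (\<Sum>a\<in>UNIV. (norm (summand a f))\<^sup>2)"
        by (intro sum_mono power_mono Tle) simp
      also have "\<dots> \<le> (norm f)\<^sup>2"
        unfolding norm_split_first_letter[of f] by simp
      finally show ?thesis
        by (simp add: q)
    qed
  qed (simp_all add: Q_def cinner_add_left cinner_scaleC_left blinfun.add_right cblinD[OF T]
      sum.distrib right_diff_distrib sum_distrib_left)
  have "clinear_on M (\<lambda>f. ell2_nth (T f) [])"
    by (simp add: clinear_on_def blinfun.add_right cblinD[OF T])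
  \<comment> \<open>On \<open>M\<close> the shifts of \<open>T f\<close> are already the prescribed
    ones, so contractivity of \<open>T\<close> leaves exactly this room.\<close>
  moreover have "(norm (ell2_nth (T f) []))\<^sup>2 \<le> Re (Q f f)" if "f \<in> M" for f
  proof -
    have "(norm (T f))\<^sup>2 \<le> (norm f)\<^sup>2"
      by (intro power_mono Tle) simp
    then show ?thesis
      unfolding norm_split_first_letter[of "T f"] by (simp add: q comm[OF that])
  qed
  ultimately obtain R where R: "clinear_on UNIV R" "\<And>f. f \<in> M \<Longrightarrow> R f = ell2_nth (T f) []"
    "\<And>f. (norm (R f))\<^sup>2 \<le> Re (Q f f)"
    using Q.contraction_extension[OF M, of "\<lambda>f. ell2_nth (T f) []"] by metis
  define e where "e x = Abs_ell2 (\<lambda>\<sigma> :: 'n list. if \<sigma> = [] then x else 0)" for x :: 'e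
  have nth_e: "ell2_nth (e x) \<sigma> = (if \<sigma> = [] then x else 0)" for x \<sigma>
  proof -
    have "(\<lambda>\<sigma>. (norm (if \<sigma> = ([] :: 'n list) then x else 0))\<^sup>2) summable_on UNIV"
      by (rule finite_nonzero_values_imp_summable_on) auto
    then show ?thesis
      unfolding e_def by (subst Abs_ell2_inverse) auto
  qed
  \<comment> \<open>\<open>copies\<close> vanishes at \<open>[]\<close> and \<open>e\<close>
    vanishes elsewhere, so the two terms set the free coordinate and the forced ones
    independently.\<close>
  define t where "t f = e (R f) + copies T f" for f
  have nil: "ell2_nth (t f) [] = R f" for f
    by (simp add: t_def nth_e ell2_nth_copies)
  have shift: "summand a (t f) = T (summand a f)" for a f
    by (rule ell2_eqI) (simp add: t_def nth_e ell2_nth_copies)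
  have word_eqI: "f = g" if "ell2_nth f [] = ell2_nth g []" "\<And>a. summand a f = summand a g"
    for f g :: "('n list, 'e) ell2"
  proof (rule ell2_eqI)
    show "ell2_nth f \<sigma> = ell2_nth g \<sigma>" for \<sigma>
      using that by (cases \<sigma>) (auto simp flip: ell2_nth_summand)
  qed
  have "clinear_on UNIV t"
    unfolding clinear_on_def
    by (intro conjI ballI allI; rule word_eqI)
      (simp_all add: nil shift clinear_onD[OF R(1)] blinfun.add_right cblinD[OF T])
  moreover have t_le: "norm (t f) \<le> norm f" for f
  proof -
    have "(norm (t f))\<^sup>2 \<le> (norm f)\<^sup>2"
      unfolding norm_split_first_letter[of "t f"] using R(3)[of f] by (simp add: nil shift q)
    then show ?thesis
      by simp
  qed
  ultimately have "\<exists>T'\<in>cblin. \<forall>f. blinfun_apply T' f = t f"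
    using cblin_of_clinear[of t 1] by (metis mult_1)
  then obtain T' where T': "T' \<in> cblin" "\<And>f. blinfun_apply T' f = t f"
    by blast
  have eq: "T' f = T f" if "f \<in> M" for f
    by (rule word_eqI) (simp_all add: T' nil shift R(2) comm that)
  have "csubspace (shift_preimage M)"
    using csubspaceD[OF M] by (simp add: csubspace_def shift_preimage_def)
  \<comment> \<open>For \<open>f\<close> in the enlarged space the shifts of \<open>T' f\<close>
    involve \<open>T\<close> at vectors of \<open>M\<close>, where \<open>T\<close> and
    \<open>T'\<close> agree.\<close>
  then have "coinvariant_contraction (shift_preimage M) T'"
    unfolding coinvariant_contraction_def
    by (auto simp: T' t_le shift eq[unfolded T'] shift_preimage_def inv)
  with eq show ?thesis
    by (rule that[rotated])
qed

text \<open>A step may change the operator off its current domain, so the limit is formed only on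
  the union \<open>U\<close>, where values stabilise, and is then extended to the whole
  space.\<close>

theorem commuting_contraction_extension:
  fixes M :: "('n::finite list, 'e::chilbert_space) ell2 set"
  assumes M: "csubspace M" and R: "clinear_on M R" and "\<And>f. f \<in> M \<Longrightarrow> norm (R f) \<le> norm f"
    and inv: "\<And>f a. f \<in> M \<Longrightarrow> summand a f \<in> M"
    and comm: "\<And>f a. f \<in> M \<Longrightarrow> summand a (R f) = R (summand a f)"
  obtains T where "T \<in> schur_class" "\<And>f. f \<in> M \<Longrightarrow> T f = R f"
proof -
  define M' where "M' n = (shift_preimage ^^ n) M" for n
  have M'_Suc: "M' (Suc n) = shift_preimage (M' n)" for n
    by (simp add: M'_def)
  obtain T0 where T0: "T0 \<in> cblin" "\<And>f. norm (blinfun_apply T0 f) \<le> norm f"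
    "\<And>f. f \<in> M \<Longrightarrow> blinfun_apply T0 f = R f"
    using cblin_contraction_extension[OF M R] assms(3) by metis
  have "coinvariant_contraction (M' 0) T0"
    by (simp add: coinvariant_contraction_def M'_def M T0 inv comm)
  \<comment> \<open>The clause for \<open>n = 0\<close> pins the start of the chain to
    \<open>T0\<close>, the operator that extends \<open>R\<close>.\<close>
  then have "\<exists>T. \<forall>n. (coinvariant_contraction (M' n) (T n) \<and> (n = 0 \<longrightarrow> T n = T0)) \<and>
      (\<forall>f\<in>M' n. T (Suc n) f = T n f)"
    by (intro dependent_nat_choice) (auto simp: M'_Suc elim: coinvariant_contraction_step)
  then obtain T where T: "\<And>n. coinvariant_contraction (M' n) (T n)" "T 0 = T0"
    and T_Suc: "\<And>n f. f \<in> M' n \<Longrightarrow> T (Suc n) f = T n f"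
    by metis
  have sub: "csubspace (M' n)" and Tn: "T n \<in> cblin" "\<And>f. norm (T n f) \<le> norm f"
    and inv': "\<And>f a. f \<in> M' n \<Longrightarrow> summand a f \<in> M' n"
    and comm': "\<And>f a. f \<in> M' n \<Longrightarrow> summand a (T n f) = T n (summand a f)" for n
    using T(1)[of n] by (auto simp: coinvariant_contraction_def)
  have mono: "f \<in> M' n \<and> T n f = T m f" if "m \<le> n" "f \<in> M' m" for m n f
    using that
  proof (induction rule: dec_induct)
    case (step n)
    then show ?case
      using inv'[of f n] by (auto simp: M'_Suc shift_preimage_def T_Suc)
  qed simp
  define U where "U = (\<Union>n. M' n)"
  \<comment> \<open>\<open>LEAST\<close> merely selects a stage; by \<open>mono\<close> every stage
    containing \<open>f\<close> gives the same value.\<close>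
  define S where "S f = T (LEAST n. f \<in> M' n) f" for f
  have S: "S f = T n f" if "f \<in> M' n" for f n
  proof -
    have "f \<in> M' (LEAST n. f \<in> M' n)"
      using that by (rule LeastI)
    from mono[OF Least_le this, of n] that show ?thesis
      by (simp add: S_def)
  qed
  have common: "\<exists>n. f \<in> M' n \<and> g \<in> M' n" if "f \<in> U" "g \<in> U" for f g
    using that mono unfolding U_def by (metis UN_iff max.cobounded1 max.cobounded2)
  have "csubspace U"
    unfolding csubspace_def
  proof (intro conjI ballI allI)
    show "0 \<in> U"
      using csubspaceD(1)[OF sub] by (auto simp: U_def)
    show "f + g \<in> U" if "f \<in> U" "g \<in> U" for f g
      using common[OF that] csubspaceD(2)[OF sub] by (auto simp: U_def)
    show "c *\<^sub>C f \<in> U" if "f \<in> U" for c f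
      using that csubspaceD(3)[OF sub] by (auto simp: U_def)
  qed
  moreover have "clinear_on U S"
    unfolding clinear_on_def
  proof (intro conjI ballI allI)
    show "S (f + g) = S f + S g" if fg: "f \<in> U" "g \<in> U" for f g
    proof -
      obtain n where "f \<in> M' n" "g \<in> M' n"
        using common[OF fg] by blast
      then show ?thesis
        using csubspaceD(2)[OF sub] by (simp add: S[of _ n] blinfun.add_right)
    qed
    show "S (c *\<^sub>C f) = c *\<^sub>C S f" if "f \<in> U" for c f
    proof -
      obtain n where "f \<in> M' n"
        using \<open>f \<in> U\<close> by (auto simp: U_def)
      then show ?thesis
        using csubspaceD(3)[OF sub] by (simp add: S[of _ n] cblinD[OF Tn(1)])
    qed
  qed
  moreover have "norm (S f) \<le> norm f" if "f \<in> U" for f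
    using that Tn(2) by (auto simp: U_def S)
  ultimately obtain L where L: "L \<in> cblin" "\<And>f. norm (blinfun_apply L f) \<le> norm f"
    "\<And>f. f \<in> U \<Longrightarrow> blinfun_apply L f = S f"
    using cblin_contraction_extension[of U S] by metis
  have L_comm: "summand a (L f) = L (summand a f)" if "f \<in> U" for a f
  proof -
    obtain n where n: "f \<in> M' n"
      using \<open>f \<in> U\<close> by (auto simp: U_def)
    then have "summand a f \<in> U"
      using inv' by (auto simp: U_def)
    with n \<open>f \<in> U\<close> show ?thesis
      by (simp add: L(3) S[of _ n] inv' comm')
  qed
  \<comment> \<open>Hence \<open>U\<close> is dense. Stage \<open>0\<close> needs only the zero
    vector, and each stage admits one more letter.\<close>
  have trunc: "restrict_ell2 {\<sigma>. length \<sigma> < k} f \<in> M' k" for k f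
  proof (induction k arbitrary: f)
    case 0
    have "restrict_ell2 {\<sigma>. length \<sigma> < 0} f = 0"
      by (rule ell2_eqI) simp
    then show ?case
      using csubspaceD(1)[OF sub] by simp
  next
    case (Suc k)
    have "summand a (restrict_ell2 {\<sigma>. length \<sigma> < Suc k} f)
        = restrict_ell2 {\<sigma>. length \<sigma> < k} (summand a f)" for a
      by (rule ell2_eqI) simp
    then show ?case
      using Suc by (simp add: M'_Suc shift_preimage_def)
  qed
  have "summand a (L f) = L (summand a f)" for a f
  proof (rule LIMSEQ_unique)
    let ?t = "\<lambda>k. restrict_ell2 {\<sigma>. length \<sigma> < k} f"
    show "(\<lambda>k. summand a (L (?t k))) \<longlonglongrightarrow> summand a (L f)"
      by (intro summand_tendsto blinfun.tendsto tendsto_const truncate_tendsto)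
    have "?t k \<in> U" for k
      using trunc by (auto simp: U_def)
    then show "(\<lambda>k. summand a (L (?t k))) \<longlonglongrightarrow> L (summand a f)"
      by (simp add: L_comm) (intro blinfun.tendsto tendsto_const summand_tendsto truncate_tendsto)
  qed
  then have "L \<in> schur_class"
    using L norm_blinfun_bound[of 1 L] by (simp add: schur_class_def upper_tri_iff)
  moreover have "L f = R f" if "f \<in> M" for f
  proof -
    have "f \<in> M' 0"
      using that by (simp add: M'_def)
    then show ?thesis
      using that L(3)[of f] S[of f 0] by (auto simp: U_def T(2) T0(3))
  qed
  ultimately show ?thesis
    by (rule that)
qed

section \<open>Equivalence of interpolation by contractions and Pick positivity\<close>

theorem theorem3p4:
  fixes Z :: "'m::finite \<Rightarrow> 'n::finite \<Rightarrow> 'e::chilbert_space \<Rightarrow>\<^sub>L 'e"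
    and B :: "'m \<Rightarrow> 'e \<Rightarrow>\<^sub>L 'e"
  assumes "\<And>k. Z k \<in> op_ball" and "inj Z" and "\<And>k. B k \<in> cblin"
  shows "(\<exists>T\<in>schur_class. \<forall>k. point_eval T (Z k) = B k) \<longleftrightarrow> positive_op (pick_matrix Z B)"
proof -
  note Z = assms(1) and B = assms(3)
  define c where "c k = adj (row_op (Z k))" for k
  define S where "S x = (\<Sum>k\<in>UNIV. c k (ell2_nth x k))" for x :: "('m, 'e) ell2"
  define D where "D x = (\<Sum>k\<in>UNIV. diag (B k) (c k (ell2_nth x k)))" for x :: "('m, 'e) ell2"
  have c: "c k \<in> cblin" for k
    unfolding c_def by (rule adj_cblin[OF row_op_cblin[OF Z]])
  have iff: "positive_op (pick_matrix Z B) \<longleftrightarrow> (\<forall>x. norm (D x) \<le> norm (S x))"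
    unfolding S_def D_def c_def by (rule positive_pick_matrix_iff[OF Z B])
  show ?thesis
  proof
    assume "\<exists>T\<in>schur_class. \<forall>k. point_eval T (Z k) = B k"
    then obtain T where T: "T \<in> upper_tri" "norm T \<le> 1" "\<And>k. point_eval T (Z k) = B k"
      by (auto simp: schur_class_def)
    \<comment> \<open>The interpolant acts as \<open>diag (B k)\<close> on the range of each
      \<open>c k\<close>, so contractivity is the Pick inequality.\<close>
    have "D x = T (S x)" for x
      by (simp add: D_def S_def c_def blinfun.sum_right upper_tri_adj_row_op[OF T(1) Z] T(3))
    then show "positive_op (pick_matrix Z B)"
      unfolding iff using order_trans[OF norm_blinfun mult_right_mono[OF T(2) norm_ge_zero]] by simp
  next
    assume "positive_op (pick_matrix Z B)"
    then have le: "norm (D x) \<le> norm (S x)" for x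
      by (simp add: iff)
    have S_lin: "S (x + y) = S x + S y" "S (t *\<^sub>C x) = t *\<^sub>C S x" "S (x - y) = S x - S y" for x y t
      by (simp_all add: S_def blinfun.add_right blinfun.diff_right sum.distrib sum_subtractf
          scaleC_sum_right cblinD[OF c])
    have D_lin: "D (x + y) = D x + D y" "D (t *\<^sub>C x) = t *\<^sub>C D x" "D (x - y) = D x - D y" for x y t
      by (simp_all add: D_def blinfun.add_right blinfun.diff_right sum.distrib sum_subtractf
          scaleC_sum_right cblinD[OF c] cblinD[OF diag_cblin[OF B]])
    define R where "R f = D (SOME x. S x = f)" for f
    \<comment> \<open>Independence of the preimage: on a difference of two preimages
      \<open>S\<close> vanishes, and by the inequality so does \<open>D\<close>.\<close>
    have R: "R (S x) = D x" for x
    proof -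
      have "S (SOME y. S y = S x) = S x"
        by (rule someI[of _ x]) simp
      then show ?thesis
        using le[of "(SOME y. S y = S x) - x"] by (simp add: R_def S_lin D_lin)
    qed
    \<comment> \<open>A backward shift acts on the coefficients by \<open>Z k a\<close> in the
      \<open>k\<close>-th slot, identically for \<open>S\<close> and \<open>D\<close>; this gives
      invariance and commutation.\<close>
    define Zx where "Zx a x = Abs_ell2 (\<lambda>k. Z k a (ell2_nth x k))" for a and x :: "('m, 'e) ell2"
    have shift: "summand a (S x) = S (Zx a x)" "summand a (D x) = D (Zx a x)" for a x
      by (simp_all add: S_def D_def c_def Zx_def ell2_nth_Abs_finite summand_sum summand_diag
          summand_adj_row_op[OF Z])
    have zero: "S 0 = 0"
      by (simp add: S_def blinfun.zero_right)
    obtain T where T: "T \<in> schur_class" "\<And>f. f \<in> range S \<Longrightarrow> T f = R f"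
    proof (rule commuting_contraction_extension[of "range S" R])
      show "csubspace (range S)"
        unfolding csubspace_def
        by (auto simp: S_lin(1,2)[symmetric] zero[symmetric] simp del: zero)
      show "clinear_on (range S) R"
        by (auto simp: clinear_on_def S_lin(1,2)[symmetric] R D_lin)
    qed (auto simp: R le shift)
    have "point_eval T (Z k) = B k" for k
    proof (rule blinfun_eqI)
      fix v :: 'e
      \<comment> \<open>A coefficient vector supported at the single node \<open>k\<close> isolates
        the condition at that node.\<close>
      define x where "x = Abs_ell2 (\<lambda>j. if j = k then v else 0)"
      have x: "ell2_nth x j = (if j = k then v else 0)" for j
        by (simp add: x_def ell2_nth_Abs_finite)
      have "blinfun_apply A (if b then v else 0) = (if b then A v else 0)"
        for A :: "'e \<Rightarrow>\<^sub>L ('n list, 'e) ell2" and b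
        by (simp add: blinfun.zero_right)
      moreover have "blinfun_apply A (if b then w else 0) = (if b then A w else 0)"
        for A :: "('n list, 'e) ell2 \<Rightarrow>\<^sub>L ('n list, 'e) ell2" and b w
        by (simp add: blinfun.zero_right)
      ultimately have "S x = c k v" "D x = diag (B k) (c k v)"
        by (simp_all add: S_def D_def x)
      then have "T (c k v) = diag (B k) (c k v)"
        using T(2)[OF rangeI, of x] R[of x] by simp
      \<comment> \<open>The coordinate of \<open>c k v\<close> at the empty word is
        \<open>v\<close>, so comparing both sides there recovers the interpolation
        condition.\<close>
      then show "point_eval T (Z k) v = B k v"
        by (simp add: point_eval_def coord.rep_eq c_def ell2_nth_adj_row_op[OF Z])
    qed
    with T(1) show "\<exists>T\<in>schur_class. \<forall>k. point_eval T (Z k) = B k"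
      by blast
  qed
qed

end
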